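(* Let $\mathcal{H}$ be an infinite dimensional complex Hilbert space and let $\mathcal{A}$ be a standard operator algebra on $\mathcal{H}$ containing the identity operator $I$. Suppose that $\mathcal{A}$ is closed under the adjoint operation. Then a map $\Phi:\mathcal{A}\rightarrow\mathcal{A}$ is a nonlinear mixed Jordan triple $*$-derivation if and only if $\Phi$ is a linear $*$-derivation. Moreover, in this case there exists an operator $T\in B(\mathcal{H})$ satisfying $T+T^{*}=0$ such that $\Phi(A)=AT-TA$ for all $A\in\mathcal{A}$, i.e., $\Phi$ is inner.
   Context: $B(\mathcal{H})$ denotes the algebra of all bounded linear operators on $\mathcal{H}$, and $\mathcal{F}(\mathcal{H})\subseteq B(\mathcal{H})$ the subalgebra of all bounded finite rank operators. A standard operator algebra on $\mathcal{H}$ is a subalgebra $\mathcal{A}$ of $B(\mathcal{H})$ containing $\mathcal{F}(\mathcal{H})$ (no topological closedness is assumed). For $A,B\in\mathcal{A}$, define $[A,B]_{*}=AB-BA^{*}$ and $A\bullet B=AB+BA^{*}$. A (not necessarily additive or linear) map $\Phi:\mathcal{A}\to\mathcal{A}$ is a nonlinear mixed Jordan triple $*$-derivation if $\Phi([A\bullet B, C]_{*})=[\Phi(A)\bullet B, C]_{*}+[A\bullet \Phi(B), C]_{*}+[A\bullet B, \Phi(C)]_{*}$ for all $A,B,C\in\mathcal{A}$. A linear $*$-derivation on $\mathcal{A}$ is a $\mathbb{C}$-linear map $\Phi:\mathcal{A}\to\mathcal{A}$ such that $\Phi(AB)=\Phi(A)B+A\Phi(B)$ for all $A,B\in\mathcal{A}$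 and $\Phi(A^{*})=\Phi(A)^{*}$ for all $A\in\mathcal{A}$. *)

theory Defs
  imports "HOL-Analysis.Analysis"
begin

class scaleC =
  fixes scaleC :: "complex \<Rightarrow> 'a \<Rightarrow> 'a"  (infixr "*\<^sub>C" 75)

class complex_vector = scaleC + ab_group_add +
  assumes scaleC_add_right: "c *\<^sub>C (x + y) = c *\<^sub>C x + c *\<^sub>C y"
    and scaleC_add_left: "(c + d) *\<^sub>C x = c *\<^sub>C x + d *\<^sub>C x"
    and scaleC_scaleC: "c *\<^sub>C d *\<^sub>C x = (c * d) *\<^sub>C x"
    and scaleC_one: "1 *\<^sub>C x = x"

global_interpretation complex_vector:
  vector_space "scaleC :: complex \<Rightarrow> 'a \<Rightarrow> 'a :: complex_vector"
  defines csubspace = complex_vector.subspace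
    and cspan = complex_vector.span
  by unfold_locales
    (simp_all add: scaleC_add_right scaleC_add_left scaleC_scaleC scaleC_one)

text \<open>
  A complex inner product space, with the inner product linear in the first argument. The
  superclass supplies the norm, its metric and topology; the last two axioms tie real scaling
  and norm to the complex structure.
\<close>

class complex_inner = complex_vector + real_normed_vector +
  fixes cinner :: "'a \<Rightarrow> 'a \<Rightarrow> complex"
  assumes cinner_commute: "cinner x y = cnj (cinner y x)"
    and cinner_add_left: "cinner (x + y) z = cinner x z + cinner y z"
    and cinner_scaleC_left: "cinner (c *\<^sub>C x) y = c * cinner x y"
    and cinner_self_ge_zero: "0 \<le> Re (cinner x x)"
    and cinner_self_eq_zero_iff: "cinner x x = 0 \<longleftrightarrow> x = 0"
    and scaleR_scaleC: "r *\<^sub>R x = complex_of_real r *\<^sub>C x"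
    and norm_eq_sqrt_cinner: "norm x = sqrt (Re (cinner x x))"

class chilbert_space = complex_inner + complete_space

text \<open>
  The algebra $B(H)$ as a type. Given compatibility with complex scaling, the library's
  (real) \<open>bounded_linear\<close> says exactly bounded and complex linear.
\<close>

typedef (overloaded) ('a :: complex_inner) bop =
  "{f :: 'a \<Rightarrow> 'a. bounded_linear f \<and> (\<forall>c x. f (c *\<^sub>C x) = c *\<^sub>C f x)}"
  morphisms bop_apply Bop
  by (intro exI[of _ "\<lambda>x. x"]) simp

setup_lifting type_definition_bop

lemma bounded_linear_scaleC: "bounded_linear (\<lambda>x :: 'a :: complex_inner. c *\<^sub>C x)"
proof (rule bounded_linear_intro[where K = "cmod c"])
  fix x y :: 'a and r :: real
  show "c *\<^sub>C (x + y) = c *\<^sub>C x + c *\<^sub>C y"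
    by (rule scaleC_add_right)
  show "c *\<^sub>C r *\<^sub>R x = r *\<^sub>R c *\<^sub>C x"
    by (simp add: scaleR_scaleC scaleC_scaleC mult.commute)
  have 1: "cinner (c *\<^sub>C x) (c *\<^sub>C x) = (c * cnj c) * cinner x x"
    by (metis cinner_commute cinner_scaleC_left complex_cnj_mult mult.assoc)
  have "Re (cinner (c *\<^sub>C x) (c *\<^sub>C x)) = (cmod c)\<^sup>2 * Re (cinner x x)"
    unfolding 1 complex_norm_square[symmetric] by simp
  then show "norm (c *\<^sub>C x) \<le> norm x * cmod c"
    by (simp add: norm_eq_sqrt_cinner real_sqrt_mult)
qed

text \<open>Multiplication in $B(H)$ is composition; everything else is pointwise.\<close>

instantiation bop :: (complex_inner) "{ring, monoid_mult, complex_vector}"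
begin

lift_definition zero_bop :: "'a bop" is "\<lambda>x. 0"
  by simp

lift_definition one_bop :: "'a bop" is "\<lambda>x. x"
  by simp

lift_definition plus_bop :: "'a bop \<Rightarrow> 'a bop \<Rightarrow> 'a bop" is "\<lambda>f g x. f x + g x"
  by (simp add: bounded_linear_add scaleC_add_right)

lift_definition uminus_bop :: "'a bop \<Rightarrow> 'a bop" is "\<lambda>f x. - f x"
  by (simp add: bounded_linear_minus)

lift_definition minus_bop :: "'a bop \<Rightarrow> 'a bop \<Rightarrow> 'a bop" is "\<lambda>f g x. f x - g x"
  by (simp add: bounded_linear_sub complex_vector.scale_right_diff_distrib)

lift_definition times_bop :: "'a bop \<Rightarrow> 'a bop \<Rightarrow> 'a bop" is "\<lambda>f g x. f (g x)"
  by (simp add: bounded_linear_compose)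

lift_definition scaleC_bop :: "complex \<Rightarrow> 'a bop \<Rightarrow> 'a bop" is "\<lambda>c f x. c *\<^sub>C f x"
  by (simp add: bounded_linear_compose[OF bounded_linear_scaleC] scaleC_scaleC mult.commute)

instance
  by standard
    (transfer; simp add: fun_eq_iff scaleC_add_right scaleC_add_left scaleC_scaleC scaleC_one
       linear_add[OF bounded_linear.linear])+

end

text \<open>The Hilbert space adjoint; on a complete space it exists by the Riesz theorem.\<close>

definition adj :: "'a :: complex_inner bop \<Rightarrow> 'a bop" where
  "adj A = (THE B. \<forall>x y. cinner (bop_apply A x) y = cinner x (bop_apply B y))"

definition finite_rank :: "'a :: complex_inner bop \<Rightarrow> bool" where
  "finite_rank A \<longleftrightarrow> (\<exists>S. finite S \<and> range (bop_apply A) = cspan S)"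

definition standard_operator_algebra :: "'a :: complex_inner bop set \<Rightarrow> bool" where
  "standard_operator_algebra \<A> \<longleftrightarrow>
     csubspace \<A> \<and> (\<forall>A\<in>\<A>. \<forall>B\<in>\<A>. A * B \<in> \<A>) \<and> {A. finite_rank A} \<subseteq> \<A>"

definition star_lie :: "'a :: complex_inner bop \<Rightarrow> 'a bop \<Rightarrow> 'a bop" where
  "star_lie A B = A * B - B * adj A"

definition star_jordan :: "'a :: complex_inner bop \<Rightarrow> 'a bop \<Rightarrow> 'a bop" where
  "star_jordan A B = A * B + B * adj A"

definition nonlinear_mixed_jordan_triple_star_derivation ::
    "'a :: complex_inner bop set \<Rightarrow> ('a bop \<Rightarrow> 'a bop) \<Rightarrow> bool" where
  "nonlinear_mixed_jordan_triple_star_derivation \<A> \<Phi> \<longleftrightarrow>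
     \<Phi> \<in> \<A> \<rightarrow> \<A> \<and>
     (\<forall>A\<in>\<A>. \<forall>B\<in>\<A>. \<forall>C\<in>\<A>.
        \<Phi> (star_lie (star_jordan A B) C) =
          star_lie (star_jordan (\<Phi> A) B) C
          + star_lie (star_jordan A (\<Phi> B)) C
          + star_lie (star_jordan A B) (\<Phi> C))"

definition linear_star_derivation ::
    "'a :: complex_inner bop set \<Rightarrow> ('a bop \<Rightarrow> 'a bop) \<Rightarrow> bool" where
  "linear_star_derivation \<A> \<Phi> \<longleftrightarrow>
     \<Phi> \<in> \<A> \<rightarrow> \<A> \<and>
     (\<forall>A\<in>\<A>. \<forall>B\<in>\<A>. \<Phi> (A + B) = \<Phi> A + \<Phi> B) \<and>
     (\<forall>c. \<forall>A\<in>\<A>. \<Phi> (c *\<^sub>C A) = c *\<^sub>C \<Phi> A) \<and>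
     (\<forall>A\<in>\<A>. \<forall>B\<in>\<A>. \<Phi> (A * B) = \<Phi> A * B + A * \<Phi> B) \<and>
     (\<forall>A\<in>\<A>. \<Phi> (adj A) = adj (\<Phi> A))"

end

theory Submission
  imports Defs
begin

text \<open>
  Why the theorem holds. A linear \<open>*\<close>-derivation respects products, sums and adjoints, so it
  respects the mixed triple product; the content is the converse. Write \<open>[A, B] = A B - B A\<^sup>*\<close>
  for \<open>star_lie\<close>.

  Additivity. Since \<open>I/2 \<bullet> A = A\<close>, a mixed triple derivation \<open>\<Phi>\<close> satisfies
  \<open>\<Phi> [A, B] = [\<Phi> A, B] + [A, \<Phi> B] + \<beta> A B\<close> for some biadditive \<open>\<beta>\<close>. Hence the
  defect \<open>D(A, B) = \<Phi> (A + B) - \<Phi> A - \<Phi> B\<close> commutes with both slots of the bracket: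
  \<open>[X, D(A, B)] = D([X, A], [X, B])\<close>, and likewise on the other side. As \<open>D\<close> vanishes as soon as
  one argument is zero, every \<open>X\<close> whose bracket kills \<open>A\<close> or \<open>B\<close> also kills \<open>D(A, B)\<close>. For a
  self-adjoint projection \<open>p\<close> and \<open>q = I - p\<close> there are enough such \<open>X\<close> to force \<open>D = 0\<close> on
  any two Peirce corners, and so everywhere (\<open>peirce_sym.additive\<close>). The projection onto a unit
  vector serves as \<open>p\<close>, because rank one operators detect when an operator vanishes
  (\<open>rank_one_prime\<close>).

  Derivation. For additive \<open>\<Phi>\<close>, suitable triples containing \<open>I\<close> and \<open>\<i> I\<close> yield
  \<open>\<Phi> I = \<Phi> (\<i> I) = 0\<close> and \<open>\<Phi> (\<i> A) = \<i> \<Phi> A\<close>. Then \<open>\<Phi>\<close> is a derivation of the bracket;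
  replacing \<open>A\<close> by \<open>\<i> A\<close> flips the sign of its second term, so \<open>\<Phi>\<close> is a derivation of the
  product, and the bracket with \<open>I\<close> gives \<open>\<Phi> (A\<^sup>*) = (\<Phi> A)\<^sup>*\<close>.

  Linearity. Scalar operators commute with everything, so \<open>\<Phi> (c I) = f(c) I\<close> for an additive
  derivation \<open>f\<close> of the complex field. Here infinite dimension enters: in finite dimension a
  nonzero \<open>f\<close> can be applied to matrix entries. If \<open>f \<noteq> 0\<close>, it is unbounded on every real interval, so
  for an orthonormal sequence \<open>e\<^sub>n\<close> there is a vector \<open>x\<close> with rapidly decreasing coordinates
  \<open>t\<^sub>n\<close> for which \<open>f(t\<^sub>n)\<close> grows faster than the bounds of the operators \<open>\<Phi> (e\<^sub>0 \<otimes> e\<^sub>n)\<close> permit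
  (\<open>additive_derivation.Phi_scaleC\<close>).

  Innerness. For a unit vector \<open>e\<close> the map \<open>T x = \<Phi> (x \<otimes> e) e\<close> satisfies \<open>\<Phi> A = T A - A T\<close>
  by the product rule and is skew-symmetric because \<open>\<Phi>\<close> preserves adjoints. An everywhere
  defined map with an everywhere defined adjoint is bounded (\<open>Hellinger_Toeplitz\<close>), so \<open>- T\<close> is
  the required operator.
\<close>

section \<open>Complex Hilbert spaces\<close>

instance chilbert_space \<subseteq> banach ..

lemma cinner_add_right: "cinner x (y + z) = cinner x y + cinner x (z :: 'a :: complex_inner)"
  by (metis cinner_add_left cinner_commute complex_cnj_add)

lemma cinner_scaleC_right: "cinner x (c *\<^sub>C y) = cnj c * cinner x (y :: 'a :: complex_inner)"
  by (metis cinner_commute cinner_scaleC_left complex_cnj_mult)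

lemma cinner_zero [simp]: "cinner 0 (x :: 'a :: complex_inner) = 0" "cinner (x :: 'a) 0 = 0"
  by (metis add_cancel_left_right cinner_add_left, metis add_cancel_left_right cinner_add_right)

lemma cinner_minus [simp]:
  "cinner (- x) (y :: 'a :: complex_inner) = - cinner x y" "cinner (x :: 'a) (- y) = - cinner x y"
  by (metis add_eq_0_iff cinner_add_left cinner_zero(1) right_minus add.commute,
      metis add_eq_0_iff cinner_add_right cinner_zero(2) right_minus add.commute)

lemma cinner_diff:
  "cinner (x - y) (z :: 'a :: complex_inner) = cinner x z - cinner y z"
  "cinner (x :: 'a) (y - z) = cinner x y - cinner x z"
  by (simp_all only: diff_conv_add_uminus cinner_add_left cinner_add_right cinner_minus)

lemma cinner_self: "cinner x x = complex_of_real ((norm (x :: 'a :: complex_inner))\<^sup>2)"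
proof -
  have "Im (cinner x x) = 0"
    using cinner_commute[of x x] by (metis complex_cnj_cancel_iff complex_eq_iff cnj.simps(2) neg_equal_zero)
  moreover have "Re (cinner x x) = (norm x)\<^sup>2"
    using cinner_self_ge_zero[of x] by (simp add: norm_eq_sqrt_cinner)
  ultimately show ?thesis
    by (simp add: complex_eq_iff)
qed

lemma norm_add_sq:
  "(norm (x + y :: 'a :: complex_inner))\<^sup>2 = (norm x)\<^sup>2 + 2 * Re (cinner x y) + (norm y)\<^sup>2"
proof -
  have "complex_of_real ((norm (x + y))\<^sup>2) = cinner (x + y) (x + y)"
    by (simp add: cinner_self)
  also have "\<dots> = cinner x x + cinner x y + cnj (cinner x y) + cinner y y"
    using cinner_commute[of y x] by (simp add: cinner_add_left cinner_add_right)
  finally have "Re (complex_of_real ((norm (x + y))\<^sup>2))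
      = Re (cinner x x + cinner x y + cnj (cinner x y) + cinner y y)"
    by simp
  then show ?thesis
    by (simp add: cinner_self)
qed

lemma norm_scaleC: "norm (c *\<^sub>C x :: 'a :: complex_inner) = cmod c * norm x"
proof -
  have "cinner (c *\<^sub>C x) (c *\<^sub>C x) = (c * cnj c) * cinner x x"
    by (simp add: cinner_scaleC_left cinner_scaleC_right)
  then have "complex_of_real ((norm (c *\<^sub>C x))\<^sup>2) = complex_of_real ((cmod c * norm x)\<^sup>2)"
    unfolding cinner_self complex_norm_square[symmetric] power_mult_distrib by simp
  then show ?thesis
    using of_real_eq_iff power2_eq_iff_nonneg by (metis mult_nonneg_nonneg norm_ge_zero)
qed

text \<open>
  The triangle inequality belongs to the norm of the class, so expanding \<open>\<parallel>u + v\<parallel>\<^sup>2\<close> already bounds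
  the real part of the inner product; rotating \<open>x\<close> by a unimodular scalar turns the real part into
  the modulus.
\<close>

lemma Cauchy_Schwarz: "cmod (cinner x y) \<le> norm x * norm (y :: 'a :: complex_inner)"
proof -
  have real: "Re (cinner u v) \<le> norm u * norm v" for u v :: 'a
    using power_mono[OF norm_triangle_ineq[of u v] norm_ge_zero, of 2]
    by (simp add: norm_add_sq power2_sum)
  show ?thesis
  proof (cases "cinner x y = 0")
    case False
    define c where "c = cnj (cinner x y) / cmod (cinner x y)"
    have "c * cinner x y = cmod (cinner x y)"
      using False complex_norm_square[of "cinner x y"]
      by (simp add: c_def power2_eq_square field_simps)
    then have "cmod (cinner x y) = Re (cinner (c *\<^sub>C x) y)"
      by (simp add: cinner_scaleC_left)
    also have "\<dots> \<le> norm (c *\<^sub>C x) * norm y"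
      by (rule real)
    also have "norm (c *\<^sub>C x) = norm x"
      using False by (simp add: norm_scaleC c_def norm_divide)
    finally show ?thesis .
  qed simp
qed

lemma cinner_eqI: "x = y" if "\<And>z. cinner x z = cinner y (z :: 'a :: complex_inner)"
  using that[of "x - y"] cinner_self_eq_zero_iff[of "x - y"] by (simp add: cinner_diff(1))

lemma cinner_eqI_right: "x = y" if "\<And>z. cinner z x = cinner z (y :: 'a :: complex_inner)"
  using that by (metis cinner_commute cinner_eqI)

lemma bounded_linear_cinner_left: "bounded_linear (\<lambda>x :: 'a :: complex_inner. cinner x y)"
proof (rule bounded_linear_intro[where K = "norm y"])
  show "cinner (r *\<^sub>R x) y = r *\<^sub>R cinner x y" for r and x :: 'a
    by (simp add: scaleR_scaleC cinner_scaleC_left scaleR_conv_of_real)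
qed (simp_all add: cinner_add_left Cauchy_Schwarz)

text \<open>
  The representing vector minimises the energy \<open>J x = \<parallel>x\<parallel>\<^sup>2 / 2 - Re (g x)\<close>. By the parallelogram
  law minimising sequences are Cauchy, and stationarity of \<open>J\<close> at the minimum says that the real
  parts of \<open>g\<close> and of the inner product agree; complex linearity gives the imaginary parts.
\<close>

theorem Riesz_representation:
  fixes g :: "'a :: chilbert_space \<Rightarrow> complex"
  assumes g: "bounded_linear g" and gC: "\<And>c x. g (c *\<^sub>C x) = c * g x"
  shows "\<exists>z. \<forall>x. g x = cinner x z"
proof -
  interpret g: bounded_linear g by fact
  define J where "J x = (norm x)\<^sup>2 / 2 - Re (g x)" for x
  obtain K where K: "\<And>x. norm (g x) \<le> norm x * K"
    using g.bounded by blast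
  have "- (K\<^sup>2 / 2) \<le> J x" for x
  proof -
    have "Re (g x) \<le> norm x * K"
      using K[of x] complex_Re_le_cmod[of "g x"] by linarith
    moreover have "0 \<le> (norm x - K)\<^sup>2"
      by simp
    ultimately show ?thesis
      by (simp add: J_def power2_diff)
  qed
  then have bdd: "bdd_below (range J)"
    unfolding bdd_below_def by blast
  define m where "m = Inf (range J)"
  have m: "m \<le> J x" for x
    unfolding m_def using bdd by (simp add: cInf_lower)
  have "\<exists>x. J x < m + inverse (real (Suc n))" for n
    using cInf_lessD[of "range J" "m + inverse (real (Suc n))"] unfolding m_def[symmetric] by auto
  then obtain x where x: "\<And>n. J (x n) < m + inverse (real (Suc n))"
    by metis
  have paral: "(norm (u - v))\<^sup>2 \<le> 4 * (J u + J v - 2 * m)" for u v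
  proof -
    have "J ((1/2) *\<^sub>R (u + v)) = (norm (u + v))\<^sup>2 / 8 - (Re (g u) + Re (g v)) / 2"
      by (simp add: J_def g.scaleR g.add power_divide del: scaleR_right_distrib)
    moreover have "(norm (u + v))\<^sup>2 + (norm (u - v))\<^sup>2 = 2 * (norm u)\<^sup>2 + 2 * (norm v)\<^sup>2"
      using norm_add_sq[of u v] norm_add_sq[of u "- v"] by simp
    ultimately show ?thesis
      using m[of "(1/2) *\<^sub>R (u + v)"] unfolding J_def[of u] J_def[of v] by argo
  qed
  have "Cauchy x"
  proof (rule metric_CauchyI)
    fix e :: real
    assume e: "0 < e"
    obtain N where N: "inverse (real (Suc N)) < e\<^sup>2 / 8"
      using reals_Archimedean[of "e\<^sup>2 / 8"] e by auto
    have "dist (x a) (x b) < e" if ab: "N \<le> a" "N \<le> b" for a b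
    proof -
      have "inverse (real (Suc a)) \<le> inverse (real (Suc N))" "inverse (real (Suc b)) \<le> inverse (real (Suc N))"
        using ab by (simp_all add: le_imp_inverse_le)
      then have "(norm (x a - x b))\<^sup>2 < e\<^sup>2"
        using paral[of "x a" "x b"] x[of a] x[of b] N by argo
      then show ?thesis
        using e by (simp add: dist_norm power_less_imp_less_base)
    qed
    then show "\<exists>M. \<forall>a\<ge>M. \<forall>b\<ge>M. dist (x a) (x b) < e"
      by blast
  qed
  then obtain z where z: "x \<longlonglongrightarrow> z"
    using Cauchy_convergent convergent_def by blast
  have "(\<lambda>n. J (x n)) \<longlonglongrightarrow> J z"
    unfolding J_def by (intro tendsto_intros g.tendsto z) simp
  moreover have "(\<lambda>n. m + inverse (real (Suc n))) \<longlonglongrightarrow> m + 0"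
    by (intro tendsto_intros LIMSEQ_inverse_real_of_nat)
  ultimately have "J z \<le> m + 0"
    by (rule LIMSEQ_le) (use x less_imp_le in blast)
  then have Jz: "J z \<le> J y" for y
    using m[of y] by linarith
  \<comment> \<open>the first variation of J at z in the direction h vanishes\<close>
  have Re_eq: "Re (g h) = Re (cinner h z)" for h
  proof -
    define d where "d = Re (cinner z h) - Re (g h)"
    have var: "0 \<le> t\<^sup>2 * (norm h)\<^sup>2 / 2 + t * d" for t
    proof -
      have "Re (cinner z (t *\<^sub>R h)) = t * Re (cinner z h)"
        by (simp add: scaleR_scaleC cinner_scaleC_right)
      then show ?thesis
        using Jz[of "z + t *\<^sub>R h"]
        by (simp add: J_def norm_add_sq g.add g.scaleR power_mult_distrib d_def algebra_simps)
    qed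
    have "d = 0"
    proof (cases "norm h = 0")
      case False
      then show ?thesis
        \<comment> \<open>the minimiser of the quadratic in t, where it equals a negative multiple of the square of d\<close>
        using var[of "- d / (norm h)\<^sup>2"] by (simp add: field_simps power2_eq_square)
          (metis mult_eq_0_iff not_square_less_zero not_less linorder_neqE_linordered_idom)
    qed (simp add: d_def)
    then show ?thesis
      using cinner_commute[of z h] by (simp add: d_def)
  qed
  have "g h = cinner h z" for h
    using Re_eq[of h] Re_eq[of "\<i> *\<^sub>C h"]
    by (simp add: gC cinner_scaleC_left complex_eq_iff)
  then show ?thesis
    by blast
qed

section \<open>Adjoints in B(H)\<close>

lemma bop_eqI: "A = B" if "\<And>x. bop_apply A x = bop_apply B x"
  using that by (metis bop_apply_inject ext)

lemma bop_bounded_linear: "bounded_linear (bop_apply A)"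
  using bop_apply[of A] by simp

lemma bop_simps [simp]:
  "bop_apply 0 x = 0" "bop_apply 1 x = x"
  "bop_apply (A + B) x = bop_apply A x + bop_apply B x"
  "bop_apply (A - B) x = bop_apply A x - bop_apply B x"
  "bop_apply (- A) x = - bop_apply A x"
  "bop_apply (A * B) x = bop_apply A (bop_apply B x)"
  "bop_apply (c *\<^sub>C A) x = c *\<^sub>C bop_apply A x"
  by (simp_all add: zero_bop.rep_eq one_bop.rep_eq plus_bop.rep_eq minus_bop.rep_eq
      uminus_bop.rep_eq times_bop.rep_eq scaleC_bop.rep_eq)

lemma bop_linear [simp]:
  "bop_apply A 0 = 0"
  "bop_apply A (x + y) = bop_apply A x + bop_apply A y"
  "bop_apply A (x - y) = bop_apply A x - bop_apply A y"
  "bop_apply A (- x) = - bop_apply A x"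
  "bop_apply A (c *\<^sub>C x) = c *\<^sub>C bop_apply A x"
  using bop_apply[of A] bop_bounded_linear[of A]
  by (simp_all add: linear_simps)

lemma bop_boundE: obtains K where "0 \<le> K" "\<And>x. norm (bop_apply A x) \<le> K * norm x"
  using bounded_linear.nonneg_bounded[OF bop_bounded_linear[of A]] by (metis mult.commute)

lemma adjoint_exists:
  fixes A :: "'a :: chilbert_space bop"
  shows "\<exists>B. \<forall>x y. cinner (bop_apply A x) y = cinner x (bop_apply B y)"
proof -
  have "\<exists>z. \<forall>x. cinner (bop_apply A x) y = cinner x z" for y
    by (rule Riesz_representation)
      (simp_all add: cinner_scaleC_left
        bounded_linear_compose[OF bounded_linear_cinner_left bop_bounded_linear])
  then obtain f where f: "\<And>x y. cinner (bop_apply A x) y = cinner x (f y)"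
    by metis
  obtain K where K: "0 \<le> K" "\<And>x. norm (bop_apply A x) \<le> K * norm x"
    by (metis bop_boundE)
  have bound: "norm (f y) \<le> norm y * K" for y
  proof (cases "f y = 0")
    case False
    have "(norm (f y))\<^sup>2 = cmod (cinner (bop_apply A (f y)) y)"
      by (simp add: f cinner_self norm_power)
    also have "\<dots> \<le> norm (bop_apply A (f y)) * norm y"
      by (rule Cauchy_Schwarz)
    also have "\<dots> \<le> (K * norm (f y)) * norm y"
      by (intro mult_right_mono K) simp
    finally show ?thesis
      using False by (simp add: power2_eq_square mult.commute mult.left_commute)
  qed (use K in simp)
  have fC: "f (c *\<^sub>C y) = c *\<^sub>C f y" for c y
    by (rule cinner_eqI_right) (simp add: f[symmetric] cinner_scaleC_right)
  have "bounded_linear f"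
  proof (rule bounded_linear_intro[OF _ _ bound])
    show "f (x + y) = f x + f y" for x y
      by (rule cinner_eqI_right) (simp add: f[symmetric] cinner_add_right)
    show "f (r *\<^sub>R x) = r *\<^sub>R f x" for r x
      by (simp add: scaleR_scaleC fC)
  qed
  then have "bop_apply (Bop f) = f"
    using fC by (simp add: Bop_inverse)
  then show ?thesis
    using f by metis
qed

lemma adj_eqI:
  fixes A :: "'a :: complex_inner bop"
  assumes "\<And>x y. cinner (bop_apply A x) y = cinner x (bop_apply B y)"
  shows "adj A = B"
  unfolding adj_def
proof (rule the_equality)
  show "C = B" if "\<forall>x y. cinner (bop_apply A x) y = cinner x (bop_apply C y)" for C
    by (intro bop_eqI cinner_eqI_right) (metis that assms)
qed (use assms in blast)

lemma cinner_adj_right: "cinner x (bop_apply (adj A) y) = cinner (bop_apply A x) y"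
  for A :: "'a :: chilbert_space bop"
  using adjoint_exists[of A] adj_eqI by metis

lemma cinner_adj_left: "cinner (bop_apply (adj A) x) y = cinner x (bop_apply A y)"
  for A :: "'a :: chilbert_space bop"
  by (metis cinner_adj_right cinner_commute)

lemma adj_simps [simp]:
  fixes A B :: "'a :: chilbert_space bop"
  shows "adj (adj A) = A" "adj (A * B) = adj B * adj A" "adj (A + B) = adj A + adj B"
    "adj (A - B) = adj A - adj B" "adj (- A) = - adj A" "adj (c *\<^sub>C A) = cnj c *\<^sub>C adj A"
    "adj (0 :: 'a bop) = 0" "adj (1 :: 'a bop) = 1"
  by (rule adj_eqI; simp add: cinner_adj_right cinner_adj_left cinner_add_left cinner_add_right
      cinner_diff cinner_scaleC_left cinner_scaleC_right)+

section \<open>Rank one operators\<close>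

lift_definition rank_one :: "'a \<Rightarrow> 'a \<Rightarrow> 'a :: complex_inner bop"
  is "\<lambda>x y z. cinner z y *\<^sub>C x"
proof (intro conjI allI)
  fix x y :: 'a
  show "bounded_linear (\<lambda>z. cinner z y *\<^sub>C x)"
  proof (rule bounded_linear_intro[where K = "norm y * norm x"])
    show "norm (cinner z y *\<^sub>C x) \<le> norm z * (norm y * norm x)" for z
      using mult_right_mono[OF Cauchy_Schwarz[of z y] norm_ge_zero[of x]]
      by (simp add: norm_scaleC mult.assoc)
  qed (simp_all add: cinner_add_left scaleC_add_left scaleR_scaleC cinner_scaleC_left scaleC_scaleC)
qed (simp add: cinner_scaleC_left scaleC_scaleC)

lemma rank_one_apply [simp]: "bop_apply (rank_one x y) z = cinner z y *\<^sub>C x"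
  by (simp add: rank_one.rep_eq)

lemma times_rank_one: "A * rank_one x y = rank_one (bop_apply A x) y"
  by (rule bop_eqI) simp

lemma adj_rank_one [simp]: "adj (rank_one x y) = rank_one y x"
  by (rule adj_eqI)
    (simp add: cinner_scaleC_left cinner_scaleC_right mult.commute cinner_commute[symmetric])

lemma finite_rank_rank_one: "finite_rank (rank_one x y)"
  unfolding finite_rank_def
proof (cases "y = 0")
  case True
  then show "\<exists>S. finite S \<and> range (bop_apply (rank_one x y)) = cspan S"
    by (intro exI[of _ "{}"]) auto
next
  case False
  have "c *\<^sub>C x \<in> range (bop_apply (rank_one x y))" for c
    using False by (intro range_eqI[of _ _ "(c / cinner y y) *\<^sub>C y"])
      (simp add: cinner_scaleC_left cinner_self_eq_zero_iff)
  then show "\<exists>S. finite S \<and> range (bop_apply (rank_one x y)) = cspan S"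
    by (intro exI[of _ "{x}"]) (auto simp: complex_vector.span_singleton)
qed

section \<open>Brackets and additivity defects\<close>

lemma bop_scaleC_mult [simp]:
  fixes A B :: "'a :: complex_inner bop"
  shows "(c *\<^sub>C A) * B = c *\<^sub>C (A * B)" "A * (c *\<^sub>C B) = c *\<^sub>C (A * B)"
  by (rule bop_eqI; simp)+

lemma bop_double_eq_zero: "A = 0" if "A + A = 0" for A :: "'a :: complex_inner bop"
proof -
  have "A = (1/2) *\<^sub>C (A + A)"
    by (simp add: scaleC_add_right flip: scaleC_add_left)
  then show ?thesis
    by (simp add: that)
qed

lemma i_scaleC_eq_zeroD: "A = 0" if "\<i> *\<^sub>C A = 0" for A :: "'a :: complex_inner bop"
  using that by simp

locale star_algebra =
  fixes \<A> :: "'a :: chilbert_space bop set"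
  assumes zero_mem [simp, intro]: "0 \<in> \<A>"
    and one_mem [simp, intro]: "1 \<in> \<A>"
    and add_mem [simp, intro]: "A \<in> \<A> \<Longrightarrow> B \<in> \<A> \<Longrightarrow> A + B \<in> \<A>"
    and scaleC_mem [simp, intro]: "A \<in> \<A> \<Longrightarrow> c *\<^sub>C A \<in> \<A>"
    and mult_mem [simp, intro]: "A \<in> \<A> \<Longrightarrow> B \<in> \<A> \<Longrightarrow> A * B \<in> \<A>"
    and adj_mem [simp, intro]: "A \<in> \<A> \<Longrightarrow> adj A \<in> \<A>"
begin

lemma uminus_mem [simp, intro]: "A \<in> \<A> \<Longrightarrow> - A \<in> \<A>"
  using scaleC_mem[of A "-1"] by simp

lemma diff_mem [simp, intro]: "A \<in> \<A> \<Longrightarrow> B \<in> \<A> \<Longrightarrow> A - B \<in> \<A>"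
  unfolding diff_conv_add_uminus by blast

lemma star_lie_mem [simp, intro]: "A \<in> \<A> \<Longrightarrow> B \<in> \<A> \<Longrightarrow> star_lie A B \<in> \<A>"
  by (simp add: star_lie_def)

end

lemma star_lie_simps [simp]:
  fixes A B C :: "'a :: chilbert_space bop"
  shows "star_lie (A + B) C = star_lie A C + star_lie B C"
    "star_lie A (B + C) = star_lie A B + star_lie A C"
    "star_lie (A - B) C = star_lie A C - star_lie B C"
    "star_lie A (B - C) = star_lie A B - star_lie A C"
    "star_lie 0 A = 0" "star_lie A 0 = 0"
  by (simp_all add: star_lie_def algebra_simps)

text \<open>
  The error term \<open>\<beta>\<close> absorbs the contribution of \<open>\<Phi> (I/2)\<close>, of which nothing is known before
  additivity; biadditivity makes it cancel from every additivity defect.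
\<close>

locale star_lie_derivation_mod_biadditive = star_algebra \<A> for \<A> :: "'a :: chilbert_space bop set" +
  fixes \<Phi> :: "'a bop \<Rightarrow> 'a bop" and \<beta> :: "'a bop \<Rightarrow> 'a bop \<Rightarrow> 'a bop"
  assumes maps [simp, intro]: "A \<in> \<A> \<Longrightarrow> \<Phi> A \<in> \<A>"
    and law: "A \<in> \<A> \<Longrightarrow> B \<in> \<A> \<Longrightarrow>
      \<Phi> (star_lie A B) = star_lie (\<Phi> A) B + star_lie A (\<Phi> B) + \<beta> A B"
    and beta_add_left: "\<beta> (A + B) C = \<beta> A C + \<beta> B C"
    and beta_add_right: "\<beta> A (B + C) = \<beta> A B + \<beta> A C"
begin

definition defect :: "'a bop \<Rightarrow> 'a bop \<Rightarrow> 'a bop" where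
  "defect A B = \<Phi> (A + B) - \<Phi> A - \<Phi> B"

lemma Phi_add: "defect A B = 0 \<Longrightarrow> \<Phi> (A + B) = \<Phi> A + \<Phi> B"
  by (simp add: defect_def algebra_simps)

lemma Phi_zero [simp]: "\<Phi> 0 = 0"
proof -
  have "\<beta> 0 0 = 0"
    using beta_add_left[of 0 0 0] by simp
  then show ?thesis
    using law[of 0 0] by simp
qed

lemma defect_zero [simp]: "defect A 0 = 0" "defect 0 A = 0"
  by (simp_all add: defect_def)

lemma defect_mem [simp, intro]: "A \<in> \<A> \<Longrightarrow> B \<in> \<A> \<Longrightarrow> defect A B \<in> \<A>"
  by (simp add: defect_def)

lemma star_lie_defect:
  assumes "X \<in> \<A>" "A \<in> \<A>" "B \<in> \<A>"
  shows "star_lie X (defect A B) = defect (star_lie X A) (star_lie X B)"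
  using law[of X "A + B"] law[of X A] law[of X B] assms
  by (simp add: defect_def beta_add_right algebra_simps)

lemma defect_star_lie:
  assumes "X \<in> \<A>" "A \<in> \<A>" "B \<in> \<A>"
  shows "star_lie (defect A B) X = defect (star_lie A X) (star_lie B X)"
  using law[of "A + B" X] law[of A X] law[of B X] assms
  by (simp add: defect_def beta_add_left algebra_simps)

text \<open>
  The engine of the additivity proof: a bracket that annihilates one argument makes the transported
  defect trivial, hence annihilates the defect itself.
\<close>

lemma star_lie_defect_zero:
  assumes "star_lie X A = 0 \<or> star_lie X B = 0" "X \<in> \<A>" "A \<in> \<A>" "B \<in> \<A>"
  shows "star_lie X (defect A B) = 0"
  using assms by (auto simp: star_lie_defect)

lemma defect_star_lie_zero:
  assumes "star_lie A X = 0 \<or> star_lie B X = 0" "X \<in> \<A>" "A \<in> \<A>" "B \<in> \<A>"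
  shows "star_lie (defect A B) X = 0"
  using assms by (auto simp: defect_star_lie)

text \<open>
  Additivity already known on the factors of a bracket propagates to its expansion, which may contain
  sums of two operators from the same corner.
\<close>

lemma star_lie_sums:
  assumes "A \<in> \<A>" "A' \<in> \<A>" "B \<in> \<A>" "B' \<in> \<A>" and "defect A A' = 0" "defect B B' = 0"
  shows "\<Phi> (star_lie (A + A') (B + B')) =
    \<Phi> (star_lie A B) + \<Phi> (star_lie A B') + \<Phi> (star_lie A' B) + \<Phi> (star_lie A' B')"
proof -
  have "\<Phi> (star_lie (A + A') (B + B')) =
      star_lie (\<Phi> (A + A')) (B + B') + star_lie (A + A') (\<Phi> (B + B')) + \<beta> (A + A') (B + B')"
    by (rule law) (use assms in auto)
  also have "\<dots> = \<Phi> (star_lie A B) + \<Phi> (star_lie A B') + \<Phi> (star_lie A' B) + \<Phi> (star_lie A' B')"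
    using assms by (simp add: law Phi_add beta_add_left beta_add_right algebra_simps)
  finally show ?thesis .
qed

end

section \<open>Additivity from the Peirce decomposition\<close>

text \<open>
  For idempotents this is the corner \<open>p \<A> q\<close>; the two equations are the form in which the
  simplifier uses membership.
\<close>

definition corner :: "'a bop set \<Rightarrow> 'a bop \<Rightarrow> 'a bop \<Rightarrow> 'a :: complex_inner bop set" where
  "corner \<A> p q = {A \<in> \<A>. p * A = A \<and> A * q = A}"

text \<open>
  The assumption \<open>prime\<close> is the instance of primeness of \<open>\<A>\<close> that lets a defect in the corner of
  \<open>p\<close> be detected by multiplying it into the corner between \<open>p\<close> and \<open>q\<close>.
\<close>

locale peirce = star_lie_derivation_mod_biadditive \<A> \<Phi> \<beta>
  for \<A> :: "'a :: chilbert_space bop set" and \<Phi> \<beta> +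
  fixes p q :: "'a bop"
  assumes p_mem [simp]: "p \<in> \<A>" and idem: "p * p = p" and selfadj: "adj p = p"
    and q_eq: "q = 1 - p"
    and prime: "D \<in> \<A> \<Longrightarrow> (\<And>C. C \<in> \<A> \<Longrightarrow> D * p * C * q = 0) \<Longrightarrow> D * p = 0"
begin

lemma q_mem [simp]: "q \<in> \<A>"
  by (simp add: q_eq)

lemma selfadj_q: "adj q = q"
  by (simp add: q_eq selfadj)

lemma proj [simp]: "p * p = p" "q * q = q" "p * q = 0" "q * p = 0"
  by (simp_all add: q_eq idem algebra_simps)

lemma proj_assoc [simp]:
  "p * (p * A) = p * A" "q * (q * A) = q * A" "p * (q * A) = 0" "q * (p * A) = 0"
  by (simp_all flip: mult.assoc)

lemma q_left: "q * A = A - p * A" and q_right: "A * q = A - A * p"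
  by (simp_all add: q_eq algebra_simps)

lemma star_lie_i_proj: "star_lie (\<i> *\<^sub>C p) A = \<i> *\<^sub>C (p * A + A * p)"
    "star_lie (\<i> *\<^sub>C q) A = \<i> *\<^sub>C (q * A + A * q)"
  by (simp_all add: star_lie_def selfadj selfadj_q scaleC_add_right)

lemma cornerD: assumes "A \<in> corner \<A> r s"
  shows "A \<in> \<A>" "r * A = A" "A * s = A"
  using assms by (simp_all add: corner_def)

lemma corner_pp: assumes "A \<in> corner \<A> p p"
  shows "q * A = 0" "A * q = 0" "q * adj A = 0" "adj A * q = 0" "p * adj A = adj A" "adj A * p = adj A"
proof -
  note A = cornerD[OF assms]
  show "q * A = 0" "A * q = 0"
    by (simp_all add: q_left q_right A)
  show *: "p * adj A = adj A" "adj A * p = adj A"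
    using arg_cong[OF A(2), of adj] arg_cong[OF A(3), of adj] by (simp_all add: selfadj)
  show "q * adj A = 0" "adj A * q = 0"
    by (simp_all add: q_left q_right *)
qed

lemma corner_pq: assumes "A \<in> corner \<A> p q"
  shows "q * A = 0" "A * p = 0" "q * adj A = adj A" "adj A * q = 0" "p * adj A = 0" "adj A * p = adj A"
proof -
  note A = cornerD[OF assms]
  show "q * A = 0" "A * p = 0"
    using A(3) by (simp_all add: q_left q_right A)
  show *: "q * adj A = adj A" "adj A * p = adj A"
    using arg_cong[OF A(2), of adj] arg_cong[OF A(3), of adj] by (simp_all add: selfadj selfadj_q)
  show "p * adj A = 0" "adj A * q = 0"
    using * by (simp_all add: q_left q_right)
qed

text \<open>
  Commuting with \<open>p\<close> says that \<open>D\<close> is block diagonal, while \<open>p D + D p = D\<close> says that its diagonal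
  blocks vanish.
\<close>

lemma commuting_and_offdiag:
  assumes "p * D = D * p" "p * D + D * p = D" shows "D = 0"
proof -
  have "p * (p * D + D * p) = p * D"
    using assms by simp
  then have "p * D = 0"
    using assms(1) by (simp add: distrib_left) (metis assms(1) add_cancel_left_left mult.assoc proj(1))
  then show ?thesis
    using assms by simp
qed

end

context peirce begin

lemma corner_adj: "A \<in> corner \<A> p q \<Longrightarrow> adj A \<in> corner \<A> q p"
  by (simp add: corner_def corner_pq)

lemma corner_uminus: "A \<in> corner \<A> r s \<Longrightarrow> - A \<in> corner \<A> r s"
  by (simp add: corner_def)

lemma corner_add: "A \<in> corner \<A> r s \<Longrightarrow> B \<in> corner \<A> r s \<Longrightarrow> A + B \<in> corner \<A> r s"
  by (simp add: corner_def algebra_simps)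

text \<open>
  The anticommutators with \<open>p\<close> and with \<open>q\<close>, as brackets by \<open>\<i> p\<close> and \<open>\<i> q\<close>, kill \<open>B\<close> and
  \<open>A\<close> respectively; both kill the defect, and they add up to twice the identity map.
\<close>

lemma defect_diag_diag:
  assumes A: "A \<in> corner \<A> p p" and B: "B \<in> corner \<A> q q"
  shows "defect A B = 0"
proof -
  let ?D = "defect A B"
  have mem: "A \<in> \<A>" "B \<in> \<A>"
    using A B by (simp_all add: corner_def)
  have "p * B = 0" "B * p = 0"
    using cornerD(2,3)[OF B] by (metis proj_assoc(3), metis mult.assoc mult_zero_right proj(4))
  then have "star_lie (\<i> *\<^sub>C p) ?D = 0" "star_lie (\<i> *\<^sub>C q) ?D = 0"
    using corner_pp[OF A] by (intro star_lie_defect_zero; simp add: star_lie_i_proj mem)+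
  then have "p * ?D + ?D * p = 0" "q * ?D + ?D * q = 0"
    unfolding star_lie_i_proj by (auto dest: i_scaleC_eq_zeroD)
  then have "?D + ?D = 0"
    by (simp add: q_left q_right algebra_simps)
  then show ?thesis
    by (rule bop_double_eq_zero)
qed

text \<open>
  The bracket by \<open>\<i> (p - q)\<close> kills exactly the operators with vanishing diagonal blocks.
\<close>

lemma star_lie_i_diff: "star_lie (\<i> *\<^sub>C (p - q)) B = (2 * \<i>) *\<^sub>C (p * B + B * p - B)"
proof -
  have "star_lie (\<i> *\<^sub>C (p - q)) B = \<i> *\<^sub>C ((p * B + B * p - B) + (p * B + B * p - B))"
    by (simp add: star_lie_def selfadj selfadj_q q_left q_right algebra_simps scaleC_add_right
        complex_vector.scale_right_diff_distrib)
  also have "\<dots> = (\<i> + \<i>) *\<^sub>C (p * B + B * p - B)"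
    by (simp only: scaleC_add_left scaleC_add_right)
  finally show ?thesis
    by simp
qed

lemma offdiagI: assumes "star_lie (\<i> *\<^sub>C (p - q)) D = 0" shows "p * D + D * p = D"
  using assms by (simp add: star_lie_i_diff)

text \<open>
  The bracket by \<open>p\<close> is the commutator and kills the diagonal part \<open>A\<close>; the bracket by
  \<open>\<i> (p - q)\<close> kills the off-diagonal part \<open>B\<close>. Nothing nonzero is killed by both.
\<close>

lemma defect_diag_offdiag:
  assumes "A \<in> \<A>" "B \<in> \<A>" and A: "p * A = A * p" and B: "p * B + B * p = B"
  shows "defect A B = 0"
proof (rule commuting_and_offdiag)
  have "star_lie p (defect A B) = 0"
    by (rule star_lie_defect_zero) (simp_all add: star_lie_def selfadj A assms(1,2))
  then show "p * defect A B = defect A B * p"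
    by (simp add: star_lie_def selfadj)
  show "p * defect A B + defect A B * p = defect A B"
    by (intro offdiagI star_lie_defect_zero) (simp_all add: star_lie_i_diff B assms(1,2))
qed

text \<open>
  No left bracket by a combination of \<open>p\<close> and \<open>q\<close> separates the two off-diagonal corners, since
  \<open>c p + d q\<close> acts on them by a scalar and minus its conjugate. The other slot does: bracketing with
  \<open>p\<close> on the right kills \<open>A\<close>, and with \<open>q\<close> kills \<open>B\<close>. Together these make the defect
  self-adjoint and block diagonal, while the bracket by \<open>\<i> (p - q)\<close> removes its diagonal blocks.
\<close>

lemma defect_pq_qp:
  assumes A: "A \<in> corner \<A> p q" and B: "B \<in> corner \<A> q p"
  shows "defect A B = 0"
proof -
  let ?D = "defect A B"
  have mem: "A \<in> \<A>" "B \<in> \<A>"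
    using A B by (simp_all add: corner_def)
  have off: "p * ?D + ?D * p = ?D"
    using corner_pq[OF A] cornerD[OF A]
    by (intro offdiagI star_lie_defect_zero) (simp_all add: star_lie_i_diff mem)
  have Bq: "B * q = 0" "q * adj B = 0"
  proof -
    show *: "B * q = 0"
      using cornerD(3)[OF B] by (metis mult.assoc mult_zero_right proj(3))
    show "q * adj B = 0"
      using arg_cong[OF *, of adj] by (simp add: selfadj_q)
  qed
  have "star_lie ?D p = 0" "star_lie ?D q = 0"
    using corner_pq[OF A] Bq
    by (intro defect_star_lie_zero; simp add: star_lie_def mem)+
  then have Dp: "?D * p = p * adj ?D" and Dq: "?D * q = q * adj ?D"
    by (simp_all add: star_lie_def)
  then have "adj ?D = ?D"
    by (simp add: q_left q_right)
  then show ?thesis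
    using Dp off by (intro commuting_and_offdiag) simp_all
qed

text \<open>
  Both operators lie in one corner, so they are produced together by a single bracket:
  \<open>[p + A, q + B] = A + B - A\<^sup>* - B A\<^sup>*\<close>. The factors are sums of a diagonal and an off-diagonal
  operator, where additivity is known, and the unwanted terms lie in other corners and split off.
\<close>

lemma defect_pq_pq:
  assumes A: "A \<in> corner \<A> p q" and B: "B \<in> corner \<A> p q"
  shows "defect A B = 0"
proof -
  note As = cornerD[OF A] corner_pq[OF A] and Bs = cornerD[OF B] corner_pq[OF B]
  have AB: "A * B = 0"
    using As(3) Bs(2) by (metis mult.assoc mult_zero_left mult_zero_right proj(4))
  let ?d = "- (B * adj A)"
  have 1: "defect p A = 0" "defect q B = 0"
    by (intro defect_diag_offdiag; simp add: As Bs)+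
  have "\<Phi> (star_lie (p + A) (q + B)) =
      \<Phi> (star_lie p q) + \<Phi> (star_lie p B) + \<Phi> (star_lie A q) + \<Phi> (star_lie A B)"
    by (rule star_lie_sums) (simp_all add: As Bs 1)
  moreover have brackets: "star_lie p q = 0" "star_lie p B = B" "star_lie A q = A - adj A" "star_lie A B = ?d"
    by (simp_all add: star_lie_def selfadj As Bs AB)
  moreover have "star_lie (p + A) (q + B) = ?d + (A + B - adj A)"
    by (simp add: brackets)
  ultimately have "\<Phi> (?d + (A + B - adj A)) = \<Phi> B + \<Phi> (A - adj A) + \<Phi> ?d"
    by (simp add: algebra_simps)
  moreover have "\<Phi> (?d + (A + B - adj A)) = \<Phi> ?d + \<Phi> (A + B - adj A)"
  proof (intro Phi_add defect_diag_offdiag)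
    have "p * (B * adj A) = B * adj A * p"
      using Bs(2) As(9) by (simp add: mult.assoc flip: mult.assoc[of p])
    then show "p * ?d = ?d * p"
      by simp
  qed (simp_all add: As Bs algebra_simps)
  moreover have "\<Phi> (A + B - adj A) = \<Phi> (A + B) + \<Phi> (- adj A)"
    using Phi_add[OF defect_pq_qp[OF corner_add[OF A B] corner_uminus[OF corner_adj[OF A]]]] by simp
  moreover have "\<Phi> (A - adj A) = \<Phi> A + \<Phi> (- adj A)"
    using Phi_add[OF defect_pq_qp[OF A corner_uminus[OF corner_adj[OF A]]]] by simp
  ultimately show ?thesis
    by (simp add: defect_def algebra_simps)
qed

text \<open>
  The defect lies in the corner of \<open>p\<close> because the bracket by \<open>\<i> q\<close> kills it. Bracketing it on the
  right with \<open>p C q\<close> multiplies everything into the off-diagonal corner, where additivity is known;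
  so the defect annihilates that corner from the left, and primeness applies.
\<close>

lemma defect_pp_pp:
  assumes A: "A \<in> corner \<A> p p" and B: "B \<in> corner \<A> p p"
  shows "defect A B = 0"
proof -
  note As = cornerD[OF A] corner_pp[OF A] and Bs = cornerD[OF B] corner_pp[OF B]
  let ?D = "defect A B"
  have "star_lie (\<i> *\<^sub>C q) ?D = 0"
    by (intro star_lie_defect_zero) (simp_all add: star_lie_i_proj As Bs)
  then have qD: "q * ?D + ?D * q = 0"
    unfolding star_lie_i_proj by (auto dest: i_scaleC_eq_zeroD)
  have qDq: "q * ?D * q = 0"
  proof (rule bop_double_eq_zero)
    have "q * (q * ?D + ?D * q) * q = q * ?D * q + q * ?D * q"
      by (simp add: distrib_left distrib_right mult.assoc)
    then show "q * ?D * q + q * ?D * q = 0"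
      by (simp add: qD)
  qed
  have "(q * ?D + ?D * q) * q = 0"
    by (simp add: qD)
  then have Dq: "?D * q = 0"
    using qDq by (simp add: distrib_left distrib_right mult.assoc)
  have adjDq: "q * adj ?D = 0"
    using arg_cong[OF Dq, of adj] by (simp add: selfadj_q)
  have "?D * p = 0"
  proof (rule prime)
    fix C assume C: "C \<in> \<A>"
    let ?C = "p * C * q"
    have cC: "?C \<in> corner \<A> p q"
      using C by (simp add: corner_def mult.assoc)
    have lie: "star_lie X ?C = X * ?C" if "q * adj X = 0" for X
      by (simp add: star_lie_def mult.assoc that)
    have "X * ?C \<in> corner \<A> p q" if "X \<in> corner \<A> p p" for X
      using that C by (simp add: corner_def mult.assoc) (simp flip: mult.assoc)
    then have "star_lie ?D ?C = 0"
      using A B C by (subst defect_star_lie) (simp_all add: lie As Bs defect_pq_pq)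
    then show "?D * p * C * q = 0"
      using lie[OF adjDq] by (simp add: mult.assoc)
  qed (simp add: As Bs)
  then show ?thesis
    using Dq by (simp add: q_right)
qed

end

text \<open>
  Every statement about \<open>p\<close> and \<open>q\<close> is also available with the two projections exchanged.
\<close>

locale peirce_sym = peirce + swap: peirce \<A> \<Phi> \<beta> q p
begin

lemma Phi_peirce:
  assumes "A \<in> \<A>"
  shows "\<Phi> A = \<Phi> (p * A * p) + \<Phi> (q * A * q) + \<Phi> (p * A * q) + \<Phi> (q * A * p)"
proof -
  have c: "r * A * s \<in> corner \<A> r s" if "r = p \<or> r = q" "s = p \<or> s = q" for r s
    using that assms by (auto simp: corner_def mult.assoc)
  let ?d = "p * A * p + q * A * q" and ?o = "p * A * q + q * A * p"
  have "A = ?d + ?o"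
    by (simp add: q_left q_right algebra_simps)
  moreover have "defect ?d ?o = 0"
    by (rule defect_diag_offdiag) (simp_all add: assms algebra_simps)
  ultimately have "\<Phi> A = \<Phi> ?d + \<Phi> ?o"
    using Phi_add by metis
  also have "\<Phi> ?d = \<Phi> (p * A * p) + \<Phi> (q * A * q)"
    by (intro Phi_add defect_diag_diag c) auto
  also have "\<Phi> ?o = \<Phi> (p * A * q) + \<Phi> (q * A * p)"
    by (intro Phi_add defect_pq_qp c) auto
  finally show ?thesis
    by (simp add: add.assoc)
qed

theorem additive:
  assumes "A \<in> \<A>" "B \<in> \<A>"
  shows "\<Phi> (A + B) = \<Phi> A + \<Phi> B"
proof -
  have c: "r * X * s \<in> corner \<A> r s" if "X \<in> \<A>" "r = p \<or> r = q" "s = p \<or> s = q" for r s X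
    using that by (auto simp: corner_def mult.assoc)
  have "\<Phi> (r * (A + B) * s) = \<Phi> (r * A * s) + \<Phi> (r * B * s)"
    if "r = p \<or> r = q" "s = p \<or> s = q" for r s
  proof -
    have "defect (r * A * s) (r * B * s) = 0"
      using that c[OF assms(1) that] c[OF assms(2) that]
        defect_pp_pp defect_pq_pq swap.defect_pp_pp swap.defect_pq_pq by auto
    then show ?thesis
      by (simp add: Phi_add distrib_left distrib_right)
  qed
  then show ?thesis
    unfolding Phi_peirce[OF add_mem[OF assms]] Phi_peirce[OF assms(1)] Phi_peirce[OF assms(2)]
    by (simp add: algebra_simps)
qed

end

section \<open>Additive mixed triple derivations are derivations\<close>

lemma star_jordan_simps [simp]:
  fixes A B C :: "'a :: chilbert_space bop"
  shows "star_jordan A (B + C) = star_jordan A B + star_jordan A C"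
  by (simp_all add: star_jordan_def algebra_simps)

lemma star_jordan_half: "star_jordan ((1/2) *\<^sub>C 1) A = (A :: 'a :: chilbert_space bop)"
  by (simp add: star_jordan_def flip: scaleC_add_left)

locale mixed_triple_derivation = star_algebra \<A> for \<A> :: "'a :: chilbert_space bop set" +
  fixes \<Phi> :: "'a bop \<Rightarrow> 'a bop"
  assumes mixed: "nonlinear_mixed_jordan_triple_star_derivation \<A> \<Phi>"
begin

lemma Phi_mem [simp, intro]: "A \<in> \<A> \<Longrightarrow> \<Phi> A \<in> \<A>"
  using mixed by (auto simp: nonlinear_mixed_jordan_triple_star_derivation_def)

lemma triple:
  assumes "A \<in> \<A>" "B \<in> \<A>" "C \<in> \<A>"
  shows "\<Phi> (star_lie (star_jordan A B) C) = star_lie (star_jordan (\<Phi> A) B) C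
    + star_lie (star_jordan A (\<Phi> B)) C + star_lie (star_jordan A B) (\<Phi> C)"
  using mixed assms by (simp add: nonlinear_mixed_jordan_triple_star_derivation_def)

text \<open>
  Putting \<open>I/2\<close> into the first slot of the triple product leaves the bracket of the other two.
\<close>

sublocale star_lie_derivation_mod_biadditive \<A> \<Phi>
  "\<lambda>A B. star_lie (star_jordan (\<Phi> ((1/2) *\<^sub>C 1)) A) B"
proof
  fix A B assume "A \<in> \<A>" "B \<in> \<A>"
  then show "\<Phi> (star_lie A B) = star_lie (\<Phi> A) B + star_lie A (\<Phi> B)
      + star_lie (star_jordan (\<Phi> ((1/2) *\<^sub>C 1)) A) B"
    using triple[of "(1/2) *\<^sub>C 1" A B] by (simp add: star_jordan_half add.commute add.left_commute)
qed simp_all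

end

locale additive_mixed_triple_derivation = mixed_triple_derivation +
  assumes add: "A \<in> \<A> \<Longrightarrow> B \<in> \<A> \<Longrightarrow> \<Phi> (A + B) = \<Phi> A + \<Phi> B"
begin

lemma Phi_uminus: "A \<in> \<A> \<Longrightarrow> \<Phi> (- A) = - \<Phi> A"
  using add[of A "- A"] by (simp add: eq_neg_iff_add_eq_0 add.commute)

lemma Phi_diff: "A \<in> \<A> \<Longrightarrow> B \<in> \<A> \<Longrightarrow> \<Phi> (A - B) = \<Phi> A - \<Phi> B"
  using add[of A "- B"] by (simp add: Phi_uminus)

text \<open>
  The triple \<open>(I, I, C)\<close> has product zero for every \<open>C\<close>, so the terms containing \<open>\<Phi> I\<close> cancel.
  The choice \<open>C = I\<close> gives self-adjointness, after which the relation is four times the commutator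
  of \<open>\<Phi> I\<close> and \<open>C\<close>.
\<close>

lemma Phi_one_selfadjoint: "adj (\<Phi> 1) = \<Phi> 1"
  and Phi_one_central: "C \<in> \<A> \<Longrightarrow> \<Phi> 1 * C = C * \<Phi> 1"
proof -
  let ?U = "\<Phi> 1"
  have *: "(?U + adj ?U) * C - C * (?U + adj ?U) + ((?U + ?U) * C - C * (adj ?U + adj ?U)) = 0"
    if "C \<in> \<A>" for C
  proof -
    have "star_lie (star_jordan 1 1) C = C * 0" "star_lie (star_jordan 1 1) (\<Phi> C) = 0" for C
      by (simp_all add: star_lie_def star_jordan_def algebra_simps)
    then show ?thesis
      using triple[of 1 1 C] that by (simp add: star_lie_def star_jordan_def algebra_simps)
  qed
  have "(?U - adj ?U) + (?U - adj ?U) = 0"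
    using *[of 1] by (simp add: algebra_simps)
  from bop_double_eq_zero[OF this] show U: "adj ?U = ?U"
    by simp
  have "(?U * C - C * ?U) + (?U * C - C * ?U) = 0" if "C \<in> \<A>"
  proof (rule bop_double_eq_zero)
    show "(?U * C - C * ?U) + (?U * C - C * ?U) + ((?U * C - C * ?U) + (?U * C - C * ?U)) = 0"
      using *[OF that] by (simp add: U algebra_simps)
  qed
  then show "?U * C = C * ?U" if "C \<in> \<A>"
    using bop_double_eq_zero[of "?U * C - C * ?U"] that by simp
qed

text \<open>
  Every triple starting with \<open>\<i> I\<close> has product zero, because \<open>\<i> I \<bullet> B = 0\<close>. Hence replacing
  \<open>\<i> I\<close> by \<open>\<Phi> (\<i> I)\<close> also gives zero. For \<open>B = \<i> I\<close> and \<open>C = I\<close> this is skewness; in general the commutator of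
  \<open>\<Phi> (\<i> I)\<close> with \<open>C\<close> is self-adjoint, and so is \<open>\<i>\<close> times it, which leaves only zero.
\<close>

lemma Phi_i_skew: "adj (\<Phi> (\<i> *\<^sub>C 1)) = - \<Phi> (\<i> *\<^sub>C 1)"
  and Phi_i_central: "C \<in> \<A> \<Longrightarrow> \<Phi> (\<i> *\<^sub>C 1) * C = C * \<Phi> (\<i> *\<^sub>C 1)"
proof -
  let ?S = "\<Phi> (\<i> *\<^sub>C 1)"
  have *: "star_lie (star_jordan ?S B) C = 0" if "B \<in> \<A>" "C \<in> \<A>" for B C
  proof -
    have "star_jordan (\<i> *\<^sub>C 1) B = 0" for B :: "'a bop"
      by (simp add: star_jordan_def)
    then show ?thesis
      using triple[of "\<i> *\<^sub>C 1" B C] that by simp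
  qed
  have "\<i> *\<^sub>C ((?S + adj ?S) + (?S + adj ?S)) = star_lie (star_jordan ?S (\<i> *\<^sub>C 1)) 1"
    by (simp add: star_lie_def star_jordan_def scaleC_add_right)
  also have "\<dots> = 0"
    by (simp add: *)
  finally have "\<i> *\<^sub>C ((?S + adj ?S) + (?S + adj ?S)) = 0" .
  from bop_double_eq_zero[OF i_scaleC_eq_zeroD[OF this]] have "?S + adj ?S = 0" .
  then show S: "adj ?S = - ?S"
    by (simp add: add_eq_0_iff)
  show "?S * C = C * ?S" if C: "C \<in> \<A>"
  proof -
    let ?K = "?S * C - C * ?S"
    have "?K = adj ?K"
      using *[OF C, of 1] by (simp add: star_lie_def star_jordan_def S)
    moreover have "\<i> *\<^sub>C ?K = adj (\<i> *\<^sub>C ?K)"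
      using *[of "\<i> *\<^sub>C C" 1] C
      by (simp add: star_lie_def star_jordan_def S complex_vector.scale_right_diff_distrib)
    ultimately have "\<i> *\<^sub>C ?K = - (\<i> *\<^sub>C ?K)"
      by (metis adj_simps(6) complex_cnj_i complex_vector.scale_minus_left)
    then have "\<i> *\<^sub>C ?K + \<i> *\<^sub>C ?K = 0"
      by (simp only: eq_neg_iff_add_eq_0)
    from i_scaleC_eq_zeroD[OF bop_double_eq_zero[OF this]] show ?thesis
      by simp
  qed
qed

text \<open>
  This is the derivation rule for the triple \<open>(I, \<i> I, C)\<close>, whose product is \<open>4 \<i> C\<close>; the common
  factor four is removed by additivity.
\<close>

lemma Phi_i_times_general:
  assumes C: "C \<in> \<A>"
  shows "\<Phi> (\<i> *\<^sub>C C) = \<i> *\<^sub>C \<Phi> C + \<i> *\<^sub>C (\<Phi> 1 * C) + \<Phi> (\<i> *\<^sub>C 1) * C"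
proof -
  let ?U = "\<Phi> 1" and ?S = "\<Phi> (\<i> *\<^sub>C 1)"
  define Z where "Z = \<Phi> (\<i> *\<^sub>C C) - (\<i> *\<^sub>C \<Phi> C + \<i> *\<^sub>C (?U * C) + ?S * C)"
  have iC: "star_lie (star_jordan 1 (\<i> *\<^sub>C 1)) X
      = (\<i> *\<^sub>C X + \<i> *\<^sub>C X) + (\<i> *\<^sub>C X + \<i> *\<^sub>C X)" for X :: "'a bop"
    by (simp add: star_lie_def star_jordan_def algebra_simps)
  have UC: "star_lie (star_jordan ?U (\<i> *\<^sub>C 1)) C
      = (\<i> *\<^sub>C (?U * C) + \<i> *\<^sub>C (?U * C)) + (\<i> *\<^sub>C (?U * C) + \<i> *\<^sub>C (?U * C))"
    using Phi_one_central[OF C]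
    by (simp add: star_lie_def star_jordan_def Phi_one_selfadjoint algebra_simps)
  have SC: "star_lie (star_jordan 1 ?S) C = (?S * C + ?S * C) + (?S * C + ?S * C)"
    using Phi_i_central[OF C]
    by (simp add: star_lie_def star_jordan_def Phi_i_skew algebra_simps)
  have "(Z + Z) + (Z + Z) = 0"
    using triple[of 1 "\<i> *\<^sub>C 1" C] C
    unfolding iC UC SC by (simp add: add Z_def algebra_simps)
  then have "Z = 0"
    using bop_double_eq_zero by blast
  then show ?thesis
    by (simp add: Z_def)
qed

lemma Phi_one: "\<Phi> 1 = 0" and Phi_i: "\<Phi> (\<i> *\<^sub>C 1) = 0"
proof -
  have "\<i> *\<^sub>C (\<Phi> 1 + \<Phi> 1) = 0"
    using Phi_i_times_general[of 1] by (simp add: scaleC_add_right)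
  from bop_double_eq_zero[OF i_scaleC_eq_zeroD[OF this]] show U: "\<Phi> 1 = 0" .
  have "\<i> *\<^sub>C (\<Phi> (\<i> *\<^sub>C 1) + \<Phi> (\<i> *\<^sub>C 1)) = \<Phi> (\<i> *\<^sub>C \<i> *\<^sub>C 1)"
    by (subst (3) Phi_i_times_general) (simp_all only: U scaleC_add_right mult_zero_left complex_vector.scale_zero_right add_0_right scaleC_mem one_mem bop_scaleC_mult mult_1_right)
  also have "\<dots> = 0"
    by (simp add: scaleC_scaleC Phi_uminus U)
  finally have "\<i> *\<^sub>C (\<Phi> (\<i> *\<^sub>C 1) + \<Phi> (\<i> *\<^sub>C 1)) = 0" .
  from bop_double_eq_zero[OF i_scaleC_eq_zeroD[OF this]] show "\<Phi> (\<i> *\<^sub>C 1) = 0" .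
qed

lemma Phi_i_times: "C \<in> \<A> \<Longrightarrow> \<Phi> (\<i> *\<^sub>C C) = \<i> *\<^sub>C \<Phi> C"
  using Phi_i_times_general by (simp add: Phi_one Phi_i)

lemma star_lie_derivation:
  assumes "A \<in> \<A>" "B \<in> \<A>"
  shows "\<Phi> (star_lie A B) = star_lie (\<Phi> A) B + star_lie A (\<Phi> B)"
proof -
  have "\<Phi> ((1/2) *\<^sub>C 1 + (1/2) *\<^sub>C 1) = 0"
    by (simp add: Phi_one flip: scaleC_add_left)
  then have "\<Phi> ((1/2) *\<^sub>C 1) + \<Phi> ((1/2) *\<^sub>C 1) = 0"
    by (simp only: add scaleC_mem one_mem)
  from bop_double_eq_zero[OF this] have "\<Phi> ((1/2) *\<^sub>C 1) = 0" .
  then show ?thesis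
    using law[OF assms] by (simp add: star_jordan_def)
qed

lemma Phi_adj: "A \<in> \<A> \<Longrightarrow> \<Phi> (adj A) = adj (\<Phi> A)"
  using star_lie_derivation[of A 1] by (simp add: star_lie_def Phi_diff Phi_one)

text \<open>
  The rule for \<open>[A, B]\<close> and the rule for \<open>[\<i> A, B] = \<i> (A B + B A\<^sup>*)\<close> add up to twice the product
  rule, the terms with \<open>A\<^sup>*\<close> cancelling.
\<close>

lemma Phi_mult:
  assumes "A \<in> \<A>" "B \<in> \<A>"
  shows "\<Phi> (A * B) = \<Phi> A * B + A * \<Phi> B"
proof -
  define Z where "Z = \<Phi> (A * B) - (\<Phi> A * B + A * \<Phi> B)"
  have minus: "\<Phi> (A * B - B * adj A) = \<Phi> A * B - B * adj (\<Phi> A) + (A * \<Phi> B - \<Phi> B * adj A)"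
    using star_lie_derivation[OF assms] by (simp add: star_lie_def)
  have "\<i> *\<^sub>C \<Phi> (A * B + B * adj A) = \<Phi> (star_lie (\<i> *\<^sub>C A) B)"
    using assms by (simp add: star_lie_def scaleC_add_right flip: Phi_i_times)
  also have "\<dots> = \<i> *\<^sub>C (\<Phi> A * B + B * adj (\<Phi> A) + (A * \<Phi> B + \<Phi> B * adj A))"
    using assms by (simp add: star_lie_derivation) (simp add: star_lie_def Phi_i_times scaleC_add_right)
  finally have plus: "\<Phi> (A * B + B * adj A) = \<Phi> A * B + B * adj (\<Phi> A) + (A * \<Phi> B + \<Phi> B * adj A)"
    by simp
  have "\<Phi> (A * B) + \<Phi> (A * B) = \<Phi> (A * B - B * adj A) + \<Phi> (A * B + B * adj A)"
    using assms by (simp add: add Phi_diff)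
  then have "Z + Z = 0"
    unfolding minus plus Z_def by (simp add: algebra_simps)
  then have "Z = 0"
    by (rule bop_double_eq_zero)
  then show ?thesis
    by (simp add: Z_def)
qed

end

lemma (in star_algebra) linear_star_derivation_imp_mixed:
  assumes "linear_star_derivation \<A> \<Phi>"
  shows "nonlinear_mixed_jordan_triple_star_derivation \<A> \<Phi>"
proof -
  have maps: "\<Phi> A \<in> \<A>" if "A \<in> \<A>" for A
    using assms that by (auto simp: linear_star_derivation_def)
  have add: "\<Phi> (A + B) = \<Phi> A + \<Phi> B" and mult: "\<Phi> (A * B) = \<Phi> A * B + A * \<Phi> B"
    and adj: "\<Phi> (adj A) = adj (\<Phi> A)" if "A \<in> \<A>" "B \<in> \<A>" for A B
    using assms that by (auto simp: linear_star_derivation_def)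
  have scale: "\<Phi> (c *\<^sub>C A) = c *\<^sub>C \<Phi> A" if "A \<in> \<A>" for c A
    using assms that by (simp add: linear_star_derivation_def)
  have uminus: "\<Phi> (- A) = - \<Phi> A" if "A \<in> \<A>" for A
    using scale[of A "-1"] that by simp
  have diff: "\<Phi> (A - B) = \<Phi> A - \<Phi> B" if "A \<in> \<A>" "B \<in> \<A>" for A B
    using add[of A "- B"] that by (simp add: uminus)
  have lie: "\<Phi> (star_lie A B) = star_lie (\<Phi> A) B + star_lie A (\<Phi> B)"
    and jordan: "\<Phi> (star_jordan A B) = star_jordan (\<Phi> A) B + star_jordan A (\<Phi> B)"
    if "A \<in> \<A>" "B \<in> \<A>" for A B
    using that by (simp_all add: star_lie_def star_jordan_def add diff mult adj maps)
  have "star_jordan A B \<in> \<A>" if "A \<in> \<A>" "B \<in> \<A>" for A B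
    using that by (simp add: star_jordan_def)
  then show ?thesis
    unfolding nonlinear_mixed_jordan_triple_star_derivation_def
    using maps by (auto simp: lie jordan)
qed

section \<open>Orthonormal sequences and everywhere defined adjoints\<close>

text \<open>
  Each additional orthogonality condition lowers the dimension by at most one, so the orthogonal
  complement of a finite set is not contained in the span of a finite set, in particular not in
  the span of the empty set.
\<close>

lemma exists_unit_orthogonal:
  fixes F :: "'a :: complex_inner set"
  assumes inf: "\<nexists>S :: 'a set. finite S \<and> cspan S = UNIV" and "finite F"
  shows "\<exists>x. norm x = 1 \<and> (\<forall>y\<in>F. cinner x y = 0)"
proof -
  have *: "\<nexists>S. finite S \<and> {x. \<forall>y\<in>F. cinner x y = 0} \<subseteq> cspan S"
    using \<open>finite F\<close>
  proof induction
    case empty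
    then show ?case
      using inf by auto
  next
    case (insert s F)
    show ?case
    proof (intro notI, elim exE conjE)
      fix S assume S: "finite S" "{x. \<forall>y\<in>insert s F. cinner x y = 0} \<subseteq> cspan S"
      have "{x. \<forall>y\<in>F. cinner x y = 0} \<noteq> {x. \<forall>y\<in>insert s F. cinner x y = 0}"
        using S insert.IH by auto
      then obtain w where w: "\<forall>y\<in>F. cinner w y = 0" "cinner w s \<noteq> 0"
        by auto
      \<comment> \<open>a vector w violating the new condition spans, together with S, the old complement\<close>
      have "x \<in> cspan (insert w S)" if x: "\<forall>y\<in>F. cinner x y = 0" for x
      proof -
        let ?c = "cinner x s / cinner w s"
        have "x - ?c *\<^sub>C w \<in> cspan S"
          using S(2) x w by (auto simp: cinner_diff cinner_scaleC_left)
        then show ?thesis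
          by (auto simp: complex_vector.span_insert)
      qed
      then have "{x. \<forall>y\<in>F. cinner x y = 0} \<subseteq> cspan (insert w S)"
        by blast
      moreover have "finite (insert w S)"
        using S(1) by simp
      ultimately show False
        using insert.IH by meson
    qed
  qed
  obtain x where "\<forall>y\<in>F. cinner x y = 0" "x \<notin> cspan {}"
    using not_ex[THEN iffD1, OF *, rule_format, of "{}"] by auto
  then have x: "\<forall>y\<in>F. cinner x y = 0" "x \<noteq> 0"
    by auto
  show ?thesis
    using x by (intro exI[of _ "complex_of_real (1 / norm x) *\<^sub>C x"])
      (simp add: norm_scaleC cinner_scaleC_left norm_divide)
qed

lemma exists_orthonormal_sequence:
  assumes inf: "\<nexists>S :: 'a :: complex_inner set. finite S \<and> cspan S = UNIV"
  shows "\<exists>e :: nat \<Rightarrow> 'a. \<forall>m n. cinner (e m) (e n) = (if m = n then 1 else 0)"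
proof -
  have "\<exists>e :: nat \<Rightarrow> 'a. \<forall>n. norm (e n) = 1 \<and> (\<forall>m<n. cinner (e n) (e m) = 0)"
  proof (rule dependent_wellorder_choice)
    show "\<exists>r. norm r = 1 \<and> (\<forall>m<n. cinner r (e m) = 0)" for n :: nat and e :: "nat \<Rightarrow> 'a"
      using exists_unit_orthogonal[OF inf, of "e ` {..<n}"] by auto
  qed auto
  then obtain e :: "nat \<Rightarrow> 'a" where e: "\<And>n. norm (e n) = 1" "\<And>m n. m < n \<Longrightarrow> cinner (e n) (e m) = 0"
    by blast
  have "cinner (e m) (e n) = (if m = n then 1 else 0)" for m n
  proof (cases m n rule: linorder_cases)
    case less
    then show ?thesis
      using e(2)[OF less] cinner_commute[of "e m" "e n"] by simp
  qed (simp_all add: e cinner_self)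
  then show ?thesis
    by blast
qed

text \<open>
  The sets \<open>{x. \<parallel>T x\<parallel> \<le> n}\<close> are closed, since the adjoint relation describes them by continuous
  conditions \<open>\<bar>\<langle>x, S y\<rangle>\<bar> \<le> n \<parallel>y\<parallel>\<close>, and they cover the space. By Baire one of them contains a
  ball, and linearity spreads the bound on that ball to a bound on \<open>T\<close>.
\<close>

theorem Hellinger_Toeplitz:
  fixes T S :: "'a :: chilbert_space \<Rightarrow> 'a"
  assumes T: "\<And>x y. cinner (T x) y = cinner x (S y)"
  shows "\<exists>B. bop_apply B = T"
proof -
  have add: "T (x + y) = T x + T y" for x y
    by (rule cinner_eqI) (simp only: T cinner_add_left)
  have scale: "T (c *\<^sub>C x) = c *\<^sub>C T x" for c x
    by (rule cinner_eqI) (simp only: T cinner_scaleC_left)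
  have diff: "T (x - y) = T x - T y" for x y
    using add[of "x - y" y] by simp
  define K where "K n = (\<Inter>y. {x. cmod (cinner x (S y)) \<le> real n * norm y})" for n :: nat
  have K: "norm (T x) \<le> real n" if "x \<in> K n" for x n
  proof -
    have "(norm (T x))\<^sup>2 = cmod (cinner x (S (T x)))"
      by (simp add: cinner_self norm_power flip: T)
    also have "\<dots> \<le> real n * norm (T x)"
      using that by (simp add: K_def)
    finally have "(norm (T x))\<^sup>2 \<le> real n * norm (T x)" .
    then show ?thesis
      by (cases "T x = 0") (simp_all add: power2_eq_square)
  qed
  have K_I: "x \<in> K n" if "norm (T x) \<le> real n" for x n
    unfolding K_def T[symmetric]
    using order_trans[OF Cauchy_Schwarz mult_right_mono[OF that norm_ge_zero]] by blast
  have "x \<in> (\<Union>n. K n)" for x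
    using real_arch_simple[of "norm (T x)"] K_I by auto
  then have "(\<Union>n. K n) = UNIV"
    by auto
  have closed: "closed (K n)" for n
    unfolding K_def
    by (intro closed_INT ballI closed_Collect_le continuous_intros
        linear_continuous_on bounded_linear_cinner_left)
  then have "interior (\<Union> (range K)) = {}" if "\<And>n. interior (K n) = {}"
    using Met_TC.metric_Baire_category_alt[of "range K"] complete_UNIV[where 'a = 'a] that by auto
  then obtain n z where "z \<in> interior (K n)"
    using \<open>(\<Union>n. K n) = UNIV\<close> by fastforce
  then obtain r where r: "r > 0" "cball z r \<subseteq> K n"
    by (auto simp: mem_interior_cball)
  have bound: "norm (T u) \<le> norm u * (2 * real n / r)" for u
  proof (cases "u = 0")
    case False
    define c where "c = r / norm u"
    have c: "c > 0"
      using False r by (simp add: c_def)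
    have "norm (T (c *\<^sub>R u)) = norm (T (z + c *\<^sub>R u) - T z)"
      by (simp add: add)
    also have "\<dots> \<le> norm (T (z + c *\<^sub>R u)) + norm (T z)"
      by (rule norm_triangle_ineq4)
    also have "\<dots> \<le> real n + real n"
      using r(1) False by (intro add_mono K subsetD[OF r(2)]) (simp_all add: dist_norm c_def)
    finally have "c * norm (T u) \<le> 2 * real n"
      using c by (simp add: scaleR_scaleC scale norm_scaleC)
    then show ?thesis
      using r(1) False by (simp add: c_def field_simps)
  qed (use diff[of 0 0] in simp)
  have "bounded_linear T"
    by (rule bounded_linear_intro[OF add _ bound]) (simp add: scaleR_scaleC scale)
  then have "bop_apply (Bop T) = T"
    by (simp add: Bop_inverse scale)
  then show ?thesis
    by blast
qed

section \<open>Linearity and innerness of additive derivations\<close>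

lemma additive_rational:
  fixes f :: "real \<Rightarrow> 'b :: real_vector"
  assumes add: "\<And>x y. f (x + y) = f x + f y" and q: "q \<in> \<rat>"
  shows "f (q * x) = q *\<^sub>R f x"
proof -
  interpret f: additive f
    by standard (rule add)
  have nat: "f (real n * x) = real n *\<^sub>R f x" for n x
    by (induction n) (simp_all add: f.zero add distrib_right scaleR_left.add)
  have int: "f (real_of_int k * x) = real_of_int k *\<^sub>R f x" for k x
  proof (cases "0 \<le> k")
    case True
    then show ?thesis
      using nat[of "nat k" x] by simp
  next
    case False
    then show ?thesis
      using nat[of "nat (- k)" x] f.minus[of "- (real_of_int k * x)"] by simp
  qed
  obtain a b where ab: "b \<noteq> 0" "q = real_of_int a / real_of_int b"
    using q by (metis Rats_cases' less_irrefl)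
  have "real_of_int b *\<^sub>R f (q * x) = real_of_int a *\<^sub>R f x"
    unfolding int[symmetric] using ab by simp
  then show ?thesis
    using ab by (metis divide_inverse_commute of_int_eq_0_iff scaleR_scaleR scaleR_left_imp_eq
        nonzero_mult_div_cancel_left times_divide_eq_right)
qed

text \<open>
  An additive function that vanishes at 1 vanishes on the rationals, so a large multiple of \<open>a\<close>
  can be moved into any neighbourhood of zero by a rational without changing the value of \<open>f\<close>.
\<close>

lemma additive_unbounded_near_zero:
  fixes f :: "real \<Rightarrow> 'b :: real_normed_vector"
  assumes add: "\<And>x y. f (x + y) = f x + f y" and one: "f 1 = 0" and a: "f a \<noteq> 0" and "e > 0"
  shows "\<exists>t. \<bar>t\<bar> \<le> e \<and> M \<le> norm (f t)"
proof -
  obtain k :: nat where k: "M / norm (f a) \<le> real k"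
    using real_arch_simple by blast
  obtain q where q: "q \<in> \<rat>" "real k * a - e < q" "q < real k * a"
    using Rats_dense_in_real[of "real k * a - e" "real k * a"] \<open>e > 0\<close> by auto
  have "f (real k * a - q) + f (q * 1) = f (real k * a)"
    unfolding add[symmetric] by simp
  then have "f (real k * a - q) = real k *\<^sub>R f a"
    using additive_rational[of f q 1] additive_rational[of f "real k" a] add q(1) one by simp
  then have "M \<le> norm (f (real k * a - q))"
    using k a by (simp add: field_simps)
  then show ?thesis
    using q by (intro exI[of _ "real k * a - q"]) auto
qed

locale additive_derivation = star_algebra \<A> for \<A> :: "'a :: chilbert_space bop set" +
  fixes \<Phi> :: "'a bop \<Rightarrow> 'a bop"
  assumes rank_one_mem [simp, intro]: "rank_one x y \<in> \<A>"
    and maps [simp, intro]: "A \<in> \<A> \<Longrightarrow> \<Phi> A \<in> \<A>"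
    and add: "A \<in> \<A> \<Longrightarrow> B \<in> \<A> \<Longrightarrow> \<Phi> (A + B) = \<Phi> A + \<Phi> B"
    and mult: "A \<in> \<A> \<Longrightarrow> B \<in> \<A> \<Longrightarrow> \<Phi> (A * B) = \<Phi> A * B + A * \<Phi> B"
begin

text \<open>
  The image of a scalar operator is central, and an operator commuting with all rank one operators
  is scalar.
\<close>

lemma Phi_scalar:
  assumes e: "norm e = 1"
  shows "\<Phi> (c *\<^sub>C 1) = cinner (bop_apply (\<Phi> (c *\<^sub>C 1)) e) e *\<^sub>C 1"
proof (rule bop_eqI)
  fix x
  let ?S = "\<Phi> (c *\<^sub>C 1)"
  have "?S * A = A * ?S" if "A \<in> \<A>" for A
    using mult[of "c *\<^sub>C 1" A] mult[of A "c *\<^sub>C 1"] that by simp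
  from arg_cong[OF this[of "rank_one x e"], of "\<lambda>B. bop_apply B e"]
  show "bop_apply ?S x = bop_apply (cinner (bop_apply ?S e) e *\<^sub>C 1) x"
    by (simp add: e cinner_self scaleC_one)
qed

text \<open>
  Let \<open>f\<close> describe \<open>\<Phi>\<close> on scalar operators and suppose that it is nonzero at a real number. With
  \<open>E\<^sub>n = e\<^sub>0 \<otimes> e\<^sub>n\<close>, \<open>X = x \<otimes> e\<^sub>0\<close> and \<open>p = e\<^sub>0 \<otimes> e\<^sub>0\<close>, the product \<open>E\<^sub>n X\<close> is the coordinate
  \<open>\<langle>x, e\<^sub>n\<rangle>\<close> times \<open>p\<close>. Comparing both evaluations of \<open>\<Phi> (E\<^sub>n X)\<close> bounds \<open>f \<langle>x, e\<^sub>n\<rangle>\<close> linearly in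
  the bound \<open>K\<^sub>n\<close> of the operator \<open>\<Phi> E\<^sub>n\<close>, with constants that do not depend on \<open>n\<close>. The coordinates
  of \<open>x\<close> can be chosen summable and yet with \<open>\<bar>f \<langle>x, e\<^sub>n\<rangle>\<bar> \<ge> n (1 + K\<^sub>n)\<close>, a contradiction.
\<close>

lemma Phi_scaleC:
  assumes inf: "\<nexists>S :: 'a set. finite S \<and> cspan S = UNIV"
    and i: "\<Phi> (\<i> *\<^sub>C 1) = 0" and A: "A \<in> \<A>"
  shows "\<Phi> (c *\<^sub>C A) = c *\<^sub>C \<Phi> A"
proof -
  obtain e :: "nat \<Rightarrow> 'a" where e: "\<And>m n. cinner (e m) (e n) = (if m = n then 1 else 0)"
    using exists_orthonormal_sequence[OF inf] by blast
  have norm_e: "norm (e n) = 1" for n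
    by (simp add: norm_eq_sqrt_cinner e)
  let ?e = "e 0" and ?p = "rank_one (e 0) (e 0)"
  define f where "f c = cinner (bop_apply (\<Phi> (c *\<^sub>C 1)) ?e) ?e" for c
  have f: "\<Phi> (c *\<^sub>C 1) = f c *\<^sub>C 1" for c
    unfolding f_def by (rule Phi_scalar[OF norm_e])
  have scale: "\<Phi> (c *\<^sub>C B) = f c *\<^sub>C B + c *\<^sub>C \<Phi> B" if "B \<in> \<A>" for c B
    using mult[of "c *\<^sub>C 1" B] that by (simp add: f)
  have f_add: "f (c + d) = f c + f d" for c d
    by (simp add: f_def scaleC_add_left add cinner_add_left)
  have f_i: "f \<i> = 0"
    by (simp add: f_def i)
  have f_mult: "f (c * d) = f c * d + c * f d" for c d
  proof -
    have "f (c * d) *\<^sub>C 1 = (f c * d + c * f d) *\<^sub>C (1 :: 'a bop)"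
      using scale[of "d *\<^sub>C 1" c] by (simp add: f scaleC_scaleC scaleC_add_left)
    from arg_cong[OF this, of "\<lambda>B. cinner (bop_apply B ?e) ?e"] show ?thesis
      by (simp add: cinner_scaleC_left e)
  qed
  have f_real: "f (complex_of_real a) = 0" for a
  proof (rule ccontr)
    assume a: "f (complex_of_real a) \<noteq> 0"
    have "\<forall>n. \<exists>K\<ge>0. \<forall>x. norm (bop_apply (\<Phi> (rank_one ?e (e n))) x) \<le> K * norm x"
      using bop_boundE by metis
    then obtain K where K0: "\<And>n. 0 \<le> K n"
      and K: "\<And>n x. norm (bop_apply (\<Phi> (rank_one ?e (e n))) x) \<le> K n * norm x"
      by metis
    have "\<exists>t. \<bar>t\<bar> \<le> (1/2) ^ n \<and> real n * (1 + K n) \<le> cmod (f (complex_of_real t))" for n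
      using a f_mult[of 1 1]
      by (intro additive_unbounded_near_zero[of "\<lambda>t. f (complex_of_real t)"]) (auto simp: f_add)
    then obtain t where t: "\<And>n. \<bar>t n\<bar> \<le> (1/2) ^ n"
      and ft: "\<And>n. real n * (1 + K n) \<le> cmod (f (complex_of_real (t n)))"
      by metis
    have "summable (\<lambda>n. norm (complex_of_real (t n) *\<^sub>C e n))"
      by (rule summable_comparison_test'[where g = "\<lambda>n. (1/2) ^ n"])
        (simp_all add: norm_scaleC norm_e t summable_geometric)
    then have sums: "(\<lambda>n. complex_of_real (t n) *\<^sub>C e n) sums (\<Sum>n. complex_of_real (t n) *\<^sub>C e n)"
      by (rule summable_sums[OF summable_norm_cancel])
    define x where "x = (\<Sum>n. complex_of_real (t n) *\<^sub>C e n)"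
    have x: "cinner x (e n) = complex_of_real (t n)" for n
    proof -
      have "(\<lambda>m. cinner (complex_of_real (t m) *\<^sub>C e m) (e n)) sums cinner x (e n)"
        unfolding x_def by (rule bounded_linear.sums[OF bounded_linear_cinner_left sums])
      moreover have "(\<lambda>m. cinner (complex_of_real (t m) *\<^sub>C e m) (e n))
          = (\<lambda>m. if m = n then complex_of_real (t m) else 0)"
        by (auto simp: cinner_scaleC_left e)
      ultimately have "(\<lambda>m. if m = n then complex_of_real (t m) else 0) sums cinner x (e n)"
        by simp
      then show ?thesis
        by (rule sums_unique2[OF _ sums_single])
    qed
    let ?X = "rank_one x ?e"
    define M where "M = norm (bop_apply (\<Phi> ?p) ?e) + norm x + norm (bop_apply (\<Phi> ?X) ?e)"
    have "real n \<le> M" for n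
    proof -
      let ?E = "rank_one ?e (e n)" and ?t = "complex_of_real (t n)"
      have "?E * ?X = ?t *\<^sub>C ?p"
        by (rule bop_eqI) (simp add: x scaleC_scaleC cinner_scaleC_left mult.commute)
      then have "f ?t *\<^sub>C ?p + ?t *\<^sub>C \<Phi> ?p = \<Phi> ?E * ?X + ?E * \<Phi> ?X"
        using scale[of ?p ?t] mult[of ?E ?X] by simp
      from arg_cong[OF this, of "\<lambda>B. bop_apply B ?e"]
      have "f ?t *\<^sub>C ?e = bop_apply (\<Phi> ?E) x + cinner (bop_apply (\<Phi> ?X) ?e) (e n) *\<^sub>C ?e
          - ?t *\<^sub>C bop_apply (\<Phi> ?p) ?e"
        by (simp add: e scaleC_one eq_diff_eq)
      then have "cmod (f ?t) = norm (bop_apply (\<Phi> ?E) x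
          + cinner (bop_apply (\<Phi> ?X) ?e) (e n) *\<^sub>C ?e - ?t *\<^sub>C bop_apply (\<Phi> ?p) ?e)"
        by (metis norm_scaleC norm_e mult.right_neutral)
      also have "\<dots> \<le> norm (bop_apply (\<Phi> ?E) x) + norm (cinner (bop_apply (\<Phi> ?X) ?e) (e n) *\<^sub>C ?e)
          + norm (?t *\<^sub>C bop_apply (\<Phi> ?p) ?e)"
        by (intro order_trans[OF norm_triangle_ineq4] add_mono norm_triangle_ineq order_refl)
      also have "\<dots> \<le> K n * norm x + norm (bop_apply (\<Phi> ?X) ?e) + norm (bop_apply (\<Phi> ?p) ?e)"
      proof (intro add_mono K)
        show "norm (cinner (bop_apply (\<Phi> ?X) ?e) (e n) *\<^sub>C ?e) \<le> norm (bop_apply (\<Phi> ?X) ?e)"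
          using Cauchy_Schwarz[of "bop_apply (\<Phi> ?X) ?e" "e n"] by (simp add: norm_scaleC norm_e)
        have "\<bar>t n\<bar> \<le> 1"
          using t[of n] power_le_one[of "1/2 :: real" n] by simp
        then show "norm (?t *\<^sub>C bop_apply (\<Phi> ?p) ?e) \<le> norm (bop_apply (\<Phi> ?p) ?e)"
          by (simp add: norm_scaleC mult_left_le_one_le)
      qed
      also have "\<dots> \<le> M * (1 + K n)"
        using K0[of n] by (simp add: M_def distrib_left distrib_right mult.commute)
      finally have "real n * (1 + K n) \<le> M * (1 + K n)"
        using ft[of n] by linarith
      then show ?thesis
        using K0[of n] by (simp add: mult_le_cancel_right)
    qed
    then show False
      using reals_Archimedean2[of M] by (meson not_less)
  qed
  \<comment> \<open>f vanishes on the reals and at the imaginary unit, hence on all complex numbers\<close>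
  have "f c = 0"
    using f_add[of "complex_of_real (Re c)" "\<i> * complex_of_real (Im c)"]
      f_mult[of \<i> "complex_of_real (Im c)"] f_i f_real complex_eq[of c] by simp
  then show ?thesis
    using scale[OF A, of c] by simp
qed

text \<open>
  With \<open>T x = \<Phi> (x \<otimes> e) e\<close>, applying the product rule for \<open>A (x \<otimes> e) = A x \<otimes> e\<close> to \<open>e\<close> gives
  \<open>T A = \<Phi> A + A T\<close>. Skewness of \<open>T\<close> comes from the product rule for
  \<open>(y \<otimes> e)\<^sup>* (x \<otimes> e) = \<langle>x, y\<rangle> (e \<otimes> e)\<close> and \<open>\<langle>\<Phi> (e \<otimes> e) e, e\<rangle> = 0\<close>.
\<close>

theorem inner_derivation:
  assumes scale: "\<And>c A. A \<in> \<A> \<Longrightarrow> \<Phi> (c *\<^sub>C A) = c *\<^sub>C \<Phi> A"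
    and star: "\<And>A. A \<in> \<A> \<Longrightarrow> \<Phi> (adj A) = adj (\<Phi> A)"
    and e: "norm (e :: 'a) = 1"
  shows "\<exists>T. T + adj T = 0 \<and> (\<forall>A\<in>\<A>. \<Phi> A = A * T - T * A)"
proof -
  define T where "T x = bop_apply (\<Phi> (rank_one x e)) e" for x
  let ?p = "rank_one e e"
  have ee: "cinner e e = 1"
    by (simp add: cinner_self e)
  have "?p * ?p = ?p"
    by (simp add: times_rank_one ee scaleC_one)
  \<comment> \<open>compressing the product rule for this idempotent to its range doubles the compression of its image\<close>
  then have "\<Phi> ?p = \<Phi> ?p * ?p + ?p * \<Phi> ?p"
    using mult[of ?p ?p] by simp
  from arg_cong[OF this, of "\<lambda>B. cinner (bop_apply B e) e"]
  have p0: "cinner (bop_apply (\<Phi> ?p) e) e = 0"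
    by (simp add: ee scaleC_one cinner_add_left cinner_scaleC_left)
  have skew: "cinner (T x) y = cinner x (- T y)" for x y
  proof -
    let ?X = "rank_one x e" and ?Y = "rank_one y e"
    have "adj ?Y * ?X = cinner x y *\<^sub>C ?p"
      by (rule bop_eqI) (simp add: scaleC_scaleC cinner_scaleC_left mult.commute)
    then have "cinner x y *\<^sub>C \<Phi> ?p = adj (\<Phi> ?Y) * ?X + adj ?Y * \<Phi> ?X"
      using mult[of "adj ?Y" ?X] scale[of ?p "cinner x y"] star[of ?Y] by simp
    from arg_cong[OF this, of "\<lambda>B. cinner (bop_apply B e) e"]
    have "0 = cinner x (T y) + cinner (T x) y"
      by (simp add: ee scaleC_one cinner_add_left cinner_scaleC_left p0 cinner_adj_left T_def)
    then show ?thesis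
      by (simp add: eq_neg_iff_add_eq_0 add.commute)
  qed
  obtain B where B: "bop_apply B = T"
    using Hellinger_Toeplitz[OF skew] by blast
  have "adj B = - B"
    by (rule adj_eqI) (simp add: B skew)
  moreover have "\<Phi> A = A * (- B) - (- B) * A" if A: "A \<in> \<A>" for A
  proof (rule bop_eqI)
    fix x
    have "T (bop_apply A x) = bop_apply (\<Phi> A) x + bop_apply A (T x)"
      using mult[of A "rank_one x e"] A by (simp add: T_def times_rank_one ee scaleC_one)
    then show "bop_apply (\<Phi> A) x = bop_apply (A * (- B) - (- B) * A) x"
      by (simp add: B)
  qed
  ultimately show ?thesis
    by (intro exI[of _ "- B"]) simp
qed

end

section \<open>Nonlinear mixed Jordan triple derivations\<close>

text \<open>
  If \<open>s v \<noteq> 0\<close>, then \<open>D r (x \<otimes> s v) s\<close> maps \<open>v\<close> to a nonzero multiple of \<open>D r x\<close>.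
\<close>

lemma rank_one_prime:
  fixes D r s :: "'a :: complex_inner bop"
  assumes "\<And>x y. rank_one x y \<in> \<A>" and "s \<noteq> 0"
    and zero: "\<And>C. C \<in> \<A> \<Longrightarrow> D * r * C * s = 0"
  shows "D * r = 0"
proof (rule bop_eqI)
  fix x
  obtain v where v: "bop_apply s v \<noteq> 0"
    using \<open>s \<noteq> 0\<close> by (metis bop_eqI bop_simps(1))
  have "D * r * rank_one x (bop_apply s v) * s = 0"
    by (intro zero assms)
  from arg_cong[OF this, of "\<lambda>B. bop_apply B v"]
  show "bop_apply (D * r) x = bop_apply 0 x"
    using v by (simp add: cinner_self_eq_zero_iff)
qed

text \<open>
  The Peirce argument for the projection onto \<open>e\<close>; the unit vector \<open>v\<close> witnesses that the
  complementary projection is nonzero.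
\<close>

theorem mixed_triple_derivation_additive:
  fixes \<A> :: "'a :: chilbert_space bop set"
  assumes "mixed_triple_derivation \<A> \<Phi>" and rank_one: "\<And>x y. rank_one x y \<in> \<A>"
    and e: "norm (e :: 'a) = 1" and v: "norm v = 1" "cinner v e = 0"
    and "A \<in> \<A>" "B \<in> \<A>"
  shows "\<Phi> (A + B) = \<Phi> A + \<Phi> B"
proof -
  interpret mixed_triple_derivation \<A> \<Phi> by fact
  let ?p = "rank_one e e"
  let ?q = "1 - ?p"
  have "bop_apply ?p e \<noteq> 0" "bop_apply ?q v \<noteq> 0"
    using e v by (auto simp: cinner_self scaleC_one)
  then have nz: "?p \<noteq> 0" "?q \<noteq> 0"
    by (metis bop_simps(1))+
  have pp: "?p * ?p = ?p"
    by (simp add: times_rank_one cinner_self e scaleC_one)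
  interpret peirce_sym \<A> \<Phi> "\<lambda>A B. star_lie (star_jordan (\<Phi> ((1/2) *\<^sub>C 1)) A) B" ?p ?q
  proof unfold_locales
    show "?q * ?q = ?q"
      by (simp add: left_diff_distrib right_diff_distrib pp)
    show "D * ?p = 0" if "\<And>C. C \<in> \<A> \<Longrightarrow> D * ?p * C * ?q = 0" for D
      by (rule rank_one_prime[OF rank_one nz(2) that])
    show "D * ?q = 0" if "\<And>C. C \<in> \<A> \<Longrightarrow> D * ?q * C * ?p = 0" for D
      by (rule rank_one_prime[OF rank_one nz(1) that])
  qed (simp_all add: rank_one pp)
  show ?thesis
    using assms(6,7) by (rule additive)
qed

theorem corollary3p4:
  fixes \<A> :: "'a :: chilbert_space bop set"
    and \<Phi> :: "'a bop \<Rightarrow> 'a bop"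
  assumes infinite_dimensional: "\<nexists>S :: 'a set. finite S \<and> cspan S = UNIV"
    and standard: "standard_operator_algebra \<A>"
    and identity: "1 \<in> \<A>"
    and adjoint_closed: "\<forall>A\<in>\<A>. adj A \<in> \<A>"
    and maps: "\<Phi> \<in> \<A> \<rightarrow> \<A>"
  shows "(nonlinear_mixed_jordan_triple_star_derivation \<A> \<Phi> \<longleftrightarrow> linear_star_derivation \<A> \<Phi>) \<and>
    (nonlinear_mixed_jordan_triple_star_derivation \<A> \<Phi> \<longrightarrow>
      (\<exists>T. T + adj T = 0 \<and> (\<forall>A\<in>\<A>. \<Phi> A = A * T - T * A)))"
proof -
  interpret star_algebra \<A>
    using standard identity adjoint_closed
    by unfold_locales (auto simp: standard_operator_algebra_def
        intro: complex_vector.subspace_0 complex_vector.subspace_add complex_vector.subspace_scale)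
  have rank_one: "rank_one x y \<in> \<A>" for x y
    using standard finite_rank_rank_one by (auto simp: standard_operator_algebra_def)
  obtain e :: 'a where e: "norm e = 1"
    using exists_unit_orthogonal[OF infinite_dimensional, of "{}"] by auto
  obtain v where v: "norm v = 1" "cinner v e = 0"
    using exists_unit_orthogonal[OF infinite_dimensional, of "{e}"] by auto
  have "linear_star_derivation \<A> \<Phi> \<and> (\<exists>T. T + adj T = 0 \<and> (\<forall>A\<in>\<A>. \<Phi> A = A * T - T * A))"
    if mixed: "nonlinear_mixed_jordan_triple_star_derivation \<A> \<Phi>"
  proof -
    interpret mixed_triple_derivation \<A> \<Phi>
      by unfold_locales (fact mixed)
    interpret additive_mixed_triple_derivation \<A> \<Phi>
      by unfold_locales
        (rule mixed_triple_derivation_additive[OF mixed_triple_derivation_axioms rank_one e v])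
    interpret D: additive_derivation \<A> \<Phi>
      by unfold_locales (auto simp: rank_one add Phi_mult)
    have scale: "\<Phi> (c *\<^sub>C A) = c *\<^sub>C \<Phi> A" if "A \<in> \<A>" for c A
      by (rule D.Phi_scaleC[OF infinite_dimensional Phi_i that])
    have "linear_star_derivation \<A> \<Phi>"
      using maps by (simp add: linear_star_derivation_def add scale Phi_mult Phi_adj)
    then show ?thesis
      using D.inner_derivation[OF scale Phi_adj e] by blast
  qed
  then show ?thesis
    using linear_star_derivation_imp_mixed by blast
qed

end
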